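(* Let $v_\pi$ be the valuation on $\mathbb{C}_p$ with $v_\pi(\pi)=1$. For $m\ge 0$ put $k_m=\lfloor (m-1)/e\rfloor$ (so $k_0=-1$), $x_m=q^m/p^{k_m+1}$, $y_0=\frac{e}{p-1}-\frac1{q-1}$ and, for $m\ge1$, $y_m=\frac{e}{p-1}-\sum_{j=1}^{m-1}\frac1{p^{k_j+1}}-\frac{q}{p^{k_m+1}(q-1)}$. Then the vertices of the Newton polygon of $\Delta_1(Z)-1=\sum_{n\ge1}P_n(\Omega)Z^n$ with respect to $v_\pi$ (excluding the point $(0,+\infty)$) are exactly the points $(x_m,y_m)$, $m\ge 0$.
   Context: $L/\mathbb{Q}_p$ finite of degree $d$, ramification index $e$, residue field of cardinality $q$; $\pi$ a uniformizer of $o_L$. $\mathcal{G}$ is a Lubin–Tate formal group over $o_L$ for $\pi$ with coordinate $Z$ and logarithm $\log_{LT}$. $\Omega\in\mathbb{C}_p$ is the period: $\exp(\Omega\log_{LT}(Z))-1$ generates the free rank one $o_L$-module of formal group homomorphisms $\mathcal{G}\to\widehat{\mathbb{G}}_m$ over $o_{\mathbb{C}_p}$. $\Delta_1(Z)=\exp(\Omega\log_{LT}(Z))$, and the polynomials $P_n(Y)\in L[Y]$ are defined by $\exp(Y\log_{LT}(Z))=\sum_{n\ge0}P_n(Y)Z^n$. The Newton polygon of $\sum a_nZ^n$ is the lower convex hull of the points $(n,v_\pi(a_n))$.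
   Formalization: For L = Q_p only "every (x_m,y_m) is a vertex" is stated; exactness is asserted for L ≠ Q_p, since for L = Q_p all these points equal (1,0) and further vertices can occur, e.g. Δ_1−1 = Z+pZ^2 for a suitable coordinate. *)

theory Defs
  imports "HOL-Analysis.Analysis" "HOL-Computational_Algebra.Computational_Algebra"
begin

unbundle no vec_syntax

section \<open>The field of p-adic complex numbers\<close>

text \<open>Fields with a multiplicative non-archimedean absolute value, which induces the metric. The
  library's \<open>norm\<close> is reserved for real vector spaces.\<close>

class nonarch_normed_field = field_char_0 + metric_space +
  fixes vabs :: "'a \<Rightarrow> real"
  assumes dist_vabs: "dist x y = vabs (x - y)"
    and vabs_mult: "vabs (x * y) = vabs x * vabs y"
    and vabs_add_le: "vabs (x + y) \<le> max (vabs x) (vabs y)"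

text \<open>In a complete field with \<open>vabs p = 1 / p\<close> the closure of the rationals is the completion of
  the rationals for the p-adic absolute value.\<close>

definition Qp :: "'a::nonarch_normed_field set" where
  "Qp = closure \<rat>"

definition algebraic_over :: "'a::field set \<Rightarrow> 'a \<Rightarrow> bool" where
  "algebraic_over K x \<longleftrightarrow> (\<exists>f. f \<noteq> 0 \<and> (\<forall>i. coeff f i \<in> K) \<and> poly f x = 0)"

text \<open>The type \<open>'a\<close> is the completion of an algebraic closure of \<open>Qp\<close>, with the absolute value
  normalised by \<open>vabs p = 1 / p\<close>; this determines it up to isometric isomorphism.\<close>

definition is_Cp ::
  "nat \<Rightarrow> 'a::{nonarch_normed_field, alg_closed_field, complete_space} itself \<Rightarrow> bool" where
  "is_Cp p T \<longleftrightarrow> prime p \<and> vabs (of_nat p :: 'a) = 1 / real p \<and>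
     closure {x :: 'a. algebraic_over Qp x} = UNIV"

definition o_Cp :: "'a::nonarch_normed_field set" where
  "o_Cp = {x. vabs x \<le> 1}"


section \<open>Finite extensions of the p-adic numbers\<close>

definition is_subfield :: "'a::field set \<Rightarrow> bool" where
  "is_subfield K \<longleftrightarrow> 0 \<in> K \<and> 1 \<in> K \<and>
     (\<forall>x\<in>K. \<forall>y\<in>K. x - y \<in> K \<and> x * y \<in> K) \<and> (\<forall>x\<in>K. inverse x \<in> K)"

definition has_degree :: "'a::field set \<Rightarrow> 'a set \<Rightarrow> nat \<Rightarrow> bool" where
  "has_degree K L d \<longleftrightarrow> (\<exists>B. finite B \<and> card B = d \<and> B \<subseteq> L \<and>
     (\<forall>x\<in>L. \<exists>!c. c \<in> B \<rightarrow>\<^sub>E K \<and> x = (\<Sum>b\<in>B. c b * b)))"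

definition finite_ext_Qp :: "'a::nonarch_normed_field set \<Rightarrow> nat \<Rightarrow> bool" where
  "finite_ext_Qp L d \<longleftrightarrow> is_subfield L \<and> Qp \<subseteq> L \<and> has_degree Qp L d"

definition o_ring :: "'a::nonarch_normed_field set \<Rightarrow> 'a set" where
  "o_ring L = {x\<in>L. vabs x \<le> 1}"

definition max_ideal :: "'a::nonarch_normed_field set \<Rightarrow> 'a set" where
  "max_ideal L = {x\<in>L. vabs x < 1}"

definition residue_card :: "'a::nonarch_normed_field set \<Rightarrow> nat" where
  "residue_card L =
     card (o_ring L // {(x, y). x \<in> o_ring L \<and> y \<in> o_ring L \<and> x - y \<in> max_ideal L})"

definition is_uniformizer :: "'a::nonarch_normed_field set \<Rightarrow> 'a \<Rightarrow> bool" where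
  "is_uniformizer L \<pi> \<longleftrightarrow> \<pi> \<in> o_ring L \<and> (*) \<pi> ` o_ring L = max_ideal L"

definition is_ramification_index :: "nat \<Rightarrow> 'a::nonarch_normed_field set \<Rightarrow> 'a \<Rightarrow> nat \<Rightarrow> bool" where
  "is_ramification_index p L \<pi> e \<longleftrightarrow> (*) (of_nat p) ` o_ring L = (*) (\<pi> ^ e) ` o_ring L"

text \<open>The valuation with \<open>v_pi \<pi> \<pi> = 1\<close>; the base \<open>vabs \<pi>\<close> of the logarithm is less than 1.\<close>

definition v_pi :: "'a::nonarch_normed_field \<Rightarrow> 'a \<Rightarrow> ereal" where
  "v_pi \<pi> x = (if x = 0 then \<infinity> else ereal (log (vabs \<pi>) (vabs x)))"


section \<open>Formal groups\<close>

text \<open>A power series in \<open>X, Y\<close> is an \<open>'a fps fps\<close>, where \<open>F $ i $ j\<close> is the coefficient of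
  \<open>X^i Y^j\<close>. All identities between power series in at most three variables are stated in
  \<open>'a fps fps fps\<close>, where \<open>G $ i $ j $ k\<close> is the coefficient of \<open>X^i Y^j Z^k\<close>.\<close>

type_synonym 'a fps3 = "'a fps fps fps"

definition var_X :: "'a::comm_ring_1 fps3" where "var_X = fps_X"
definition var_Y :: "'a::comm_ring_1 fps3" where "var_Y = fps_const fps_X"
definition var_Z :: "'a::comm_ring_1 fps3" where "var_Z = fps_const (fps_const fps_X)"

text \<open>The substitutions \<open>f(G)\<close> and \<open>F(G, H)\<close>, for \<open>G\<close> and \<open>H\<close> without constant term: then \<open>G^i\<close>
  and \<open>G^i H^j\<close> have no terms of total degree less than \<open>i\<close> and \<open>i + j\<close>, so the sums can be cut off
  at the total degree of the monomial. The operation \<open>fps_compose\<close> does not apply, since it wants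
  the constant coefficient with respect to the outermost variable to vanish.\<close>

definition subst1 :: "'a::comm_ring_1 fps \<Rightarrow> 'a fps3 \<Rightarrow> 'a fps3" where
  "subst1 f G = Abs_fps (\<lambda>a. Abs_fps (\<lambda>b. Abs_fps (\<lambda>c.
     \<Sum>i\<le>a+b+c. f $ i * (G ^ i) $ a $ b $ c)))"

definition subst2 :: "'a::comm_ring_1 fps fps \<Rightarrow> 'a fps3 \<Rightarrow> 'a fps3 \<Rightarrow> 'a fps3" where
  "subst2 F G H = Abs_fps (\<lambda>a. Abs_fps (\<lambda>b. Abs_fps (\<lambda>c.
     \<Sum>i\<le>a+b+c. \<Sum>j\<le>a+b+c. F $ i $ j * (G ^ i * H ^ j) $ a $ b $ c)))"

text \<open>One-dimensional commutative formal group laws with coefficients in \<open>R\<close>. The first three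
  conditions say \<open>F(X, 0) = X\<close>, \<open>F(0, Y) = Y\<close> and \<open>F(X, Y) = F(Y, X)\<close>.\<close>

definition formal_group_law :: "'a::comm_ring_1 set \<Rightarrow> 'a fps fps \<Rightarrow> bool" where
  "formal_group_law R F \<longleftrightarrow> (\<forall>i j. F $ i $ j \<in> R) \<and>
     (\<forall>i. F $ i $ 0 = (if i = 1 then 1 else 0)) \<and>
     (\<forall>j. F $ 0 $ j = (if j = 1 then 1 else 0)) \<and>
     (\<forall>i j. F $ i $ j = F $ j $ i) \<and>
     subst2 F (subst2 F var_X var_Y) var_Z = subst2 F var_X (subst2 F var_Y var_Z)"

definition formal_hom ::
  "'a::comm_ring_1 set \<Rightarrow> 'a fps fps \<Rightarrow> 'a fps fps \<Rightarrow> 'a fps \<Rightarrow> bool" where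
  "formal_hom R F G f \<longleftrightarrow> (\<forall>n. f $ n \<in> R) \<and> f $ 0 = 0 \<and>
     subst1 f (subst2 F var_X var_Y) = subst2 G (subst1 f var_X) (subst1 f var_Y)"

definition additive_group :: "'a::comm_ring_1 fps fps" where
  "additive_group = fps_X + fps_const fps_X"

definition multiplicative_group :: "'a::comm_ring_1 fps fps" where
  "multiplicative_group = fps_X + fps_const fps_X + fps_X * fps_const fps_X"

text \<open>Lubin--Tate formal groups, regarded as formal modules over the ring of integers: \<open>br a\<close> is
  the endomorphism \<open>[a]\<close>, and \<open>[\<pi>](Z)\<close> is congruent to \<open>Z^q\<close> modulo \<open>\<pi>\<close>.\<close>

definition lubin_tate_group ::
  "'a::nonarch_normed_field set \<Rightarrow> 'a \<Rightarrow> 'a fps fps \<Rightarrow> ('a \<Rightarrow> 'a fps) \<Rightarrow> bool" where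
  "lubin_tate_group L \<pi> F br \<longleftrightarrow> formal_group_law (o_ring L) F \<and>
     (\<forall>a\<in>o_ring L. formal_hom (o_ring L) F F (br a) \<and> br a $ 1 = a) \<and>
     br 1 = fps_X \<and>
     (\<forall>a\<in>o_ring L. \<forall>b\<in>o_ring L. br (a * b) = br a oo br b \<and>
        subst1 (br (a + b)) var_X = subst2 F (subst1 (br a) var_X) (subst1 (br b) var_X)) \<and>
     (\<forall>n. (br \<pi> - fps_X ^ residue_card L) $ n \<in> (*) \<pi> ` o_ring L)"

definition is_formal_log ::
  "'a::nonarch_normed_field set \<Rightarrow> 'a fps fps \<Rightarrow> 'a fps \<Rightarrow> bool" where
  "is_formal_log L F l \<longleftrightarrow> formal_hom L F additive_group l \<and> l $ 1 = 1"

definition Delta1 :: "'a::field_char_0 \<Rightarrow> 'a fps \<Rightarrow> 'a fps" where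
  "Delta1 \<Omega> l = fps_exp \<Omega> oo l"

text \<open>\<open>Delta1 \<Omega> l - 1\<close> is a basis of the module of homomorphisms to the multiplicative group, on
  which \<open>a\<close> acts by composition with \<open>[a]\<close>.\<close>

definition is_period ::
  "'a::nonarch_normed_field set \<Rightarrow> 'a fps fps \<Rightarrow> ('a \<Rightarrow> 'a fps) \<Rightarrow> 'a fps \<Rightarrow> 'a \<Rightarrow> bool" where
  "is_period L F br l \<Omega> \<longleftrightarrow>
     formal_hom o_Cp F multiplicative_group (Delta1 \<Omega> l - 1) \<and>
     (\<forall>t. formal_hom o_Cp F multiplicative_group t \<longrightarrow>
        (\<exists>!a. a \<in> o_ring L \<and> t = (Delta1 \<Omega> l - 1) oo br a))"

text \<open>The coefficients of \<open>exp(Y l(Z))\<close> as a power series in \<open>Z\<close> over the polynomials in \<open>Y\<close>: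
  the series \<open>exp(Y T)\<close> in \<open>T\<close>, composed with \<open>l\<close>.\<close>

definition P_poly :: "'a::field_char_0 fps \<Rightarrow> nat \<Rightarrow> 'a poly" where
  "P_poly l n = (Abs_fps (\<lambda>k. monom (1 / fact k) k) oo Abs_fps (\<lambda>i. [:l $ i:])) $ n"


section \<open>Newton polygons\<close>

text \<open>The lower convex hull is encoded by the region on and above it; points with infinite
  valuation do not contribute.\<close>

definition newton_region :: "('a \<Rightarrow> ereal) \<Rightarrow> 'a::zero fps \<Rightarrow> (real \<times> real) set" where
  "newton_region v f = convex hull {(real n, y) | n y. v (f $ n) \<le> ereal y}"

definition newton_vertices :: "('a \<Rightarrow> ereal) \<Rightarrow> 'a::zero fps \<Rightarrow> (real \<times> real) set" where
  "newton_vertices v f = {z. z extreme_point_of newton_region v f}"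

definition k_exp :: "nat \<Rightarrow> nat \<Rightarrow> int" where
  "k_exp e m = \<lfloor>(real m - 1) / real e\<rfloor>"

definition x_vert :: "nat \<Rightarrow> nat \<Rightarrow> nat \<Rightarrow> nat \<Rightarrow> real" where
  "x_vert p e q m = real q ^ m / real p powi (k_exp e m + 1)"

definition y_vert :: "nat \<Rightarrow> nat \<Rightarrow> nat \<Rightarrow> nat \<Rightarrow> real" where
  "y_vert p e q m =
     (if m = 0 then real e / (real p - 1) - 1 / (real q - 1)
      else real e / (real p - 1) - (\<Sum>j = 1..m - 1. 1 / real p powi (k_exp e j + 1))
             - real q / (real p powi (k_exp e m + 1) * (real q - 1)))"

end

theory Submission
  imports Defs
begin

text \<open>
  Let \<open>t = \<Delta>\<^sub>1 - 1\<close> and let \<open>M u\<close> be the valuation of its Gauss norm on the circle of valuation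
  \<open>u > 0\<close>, a concave piecewise affine function with integral slopes. Gauss norms are compatible with
  composition, and those of \<open>[\<pi>](Z)\<close> and \<open>(1 + Z)^p - 1\<close> are explicit, so \<open>t \<circ> [p] = (1 + t)^p - 1\<close>
  turns into the functional equation \<open>min (p M u) (M u + e) = M (H\<^sup>e u)\<close> with
  \<open>H u = min (q u) (u + 1)\<close>, while \<open>M u = u + v(\<Omega>)\<close> for large \<open>u\<close>. Concavity of \<open>M\<close> leaves only the
  values \<open>y\<^sub>0, y\<^sub>0 + 1, \<dots>\<close> for \<open>v(\<Omega>)\<close>. If \<open>v(\<Omega>) \<ge> y\<^sub>0 + 1\<close>, then \<open>exp((\<Omega>/\<pi>) l) - 1\<close> converges far enough
  for its integrality to follow from that of its composition \<open>t\<close> with \<open>[\<pi>]\<close>; this contradicts that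
  \<open>t\<close> is a generator. Hence \<open>v(\<Omega>) = y\<^sub>0\<close>, and the functional equation gives
  \<open>M u = x\<^sub>m u + y\<^sub>m\<close> for \<open>1 / (q^m (q - 1)) \<le> u \<le> 1 / (q^(m-1) (q - 1))\<close>.
\<close>

section \<open>Non-archimedean absolute values\<close>

text \<open>\<open>M\<close> and the Newton polygon are Legendre dual: a segment of \<open>M\<close>
  on a line of slope \<open>x\<close> and constant term \<open>y\<close> is the vertex
  \<open>(x, y)\<close>, and the kinks of \<open>M\<close> lie at the negatives of the edge slopes.
  So a functional equation for \<open>M\<close> suffices, without locating zeros or torsion points.
  The equation cannot determine the valuation of \<Omega> by itself: \<open>t\<close> composed with
  \<open>[\<pi>^k]\<close> satisfies it as well and has \<open>\<pi>^k * \<Omega>\<close> in place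
  of \<Omega>. This ambiguity is all that concavity leaves, and only the generator property can
  remove it; it enters through division by \<pi>. Equality of the two sets of vertices needs
  \<open>d \<noteq> 1\<close>. For \<open>d = 1\<close> all points \<open>(x_m, y_m)\<close> are
  \<open>(1, 0)\<close>, while further unit coefficients may give further vertices, as for
  \<open>t = Z + Z^2\<close>, which arises from the multiplicative group by a change of coordinate.
  For \<open>d \<noteq> 1\<close> the \<open>x_m\<close> are unbounded, and every index lies below
  some \<open>x_m\<close>.\<close>

lemma vabs_0 [simp]: "vabs (0::'a::nonarch_normed_field) = 0"
  using dist_vabs[of "0::'a" 0] by simp

lemma vabs_nonneg [simp]: "vabs (x::'a::nonarch_normed_field) \<ge> 0"
  using dist_vabs[of x 0] zero_le_dist[of x 0] by simp

lemma vabs_eq_0_iff [simp]: "vabs (x::'a::nonarch_normed_field) = 0 \<longleftrightarrow> x = 0"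
  using dist_vabs[of x 0] dist_eq_0_iff[of x 0] by simp

lemma vabs_pos_iff [simp]: "vabs (x::'a::nonarch_normed_field) > 0 \<longleftrightarrow> x \<noteq> 0"
  using vabs_nonneg[of x] vabs_eq_0_iff[of x] by linarith

lemma vabs_1 [simp]: "vabs (1::'a::nonarch_normed_field) = 1"
  using vabs_mult[of "1::'a" 1] vabs_eq_0_iff[of "1::'a"] by simp

lemma vabs_minus [simp]: "vabs (- x::'a::nonarch_normed_field) = vabs x"
  using dist_vabs[of x 0] dist_vabs[of 0 x] by (simp add: dist_commute)

lemma vabs_diff_le: "vabs (x - y ::'a::nonarch_normed_field) \<le> max (vabs x) (vabs y)"
  using vabs_add_le[of x "- y"] by simp

lemma vabs_power: "vabs ((x::'a::nonarch_normed_field) ^ n) = vabs x ^ n"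
  by (induction n) (simp_all add: vabs_mult)

lemma vabs_inverse: "vabs (inverse (x::'a::nonarch_normed_field)) = inverse (vabs x)"
proof (cases "x = 0")
  case False
  then have "vabs x * vabs (inverse x) = 1"
    by (simp flip: vabs_mult)
  then show ?thesis by (metis inverse_unique)
qed simp

lemma vabs_divide: "vabs (x / y ::'a::nonarch_normed_field) = vabs x / vabs y"
  by (simp add: divide_inverse vabs_mult vabs_inverse)

lemma vabs_add_eq: "vabs (y::'a::nonarch_normed_field) < vabs x \<Longrightarrow> vabs (x + y) = vabs x"
  using vabs_add_le[of x y] vabs_diff_le[of "x + y" y] by auto

lemma vabs_sum_le:
  assumes "\<And>i. i \<in> A \<Longrightarrow> vabs (f i ::'a::nonarch_normed_field) \<le> B" "0 \<le> B"
  shows "vabs (sum f A) \<le> B"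
  using assms
proof (induction A rule: infinite_finite_induct)
  case (insert x A)
  then have "vabs (f x) \<le> B" "vabs (sum f A) \<le> B" by auto
  with insert.hyps show ?case using vabs_add_le[of "f x" "sum f A"] by simp
qed auto

lemma vabs_sum_less:
  assumes "\<And>i. i \<in> A \<Longrightarrow> vabs (f i ::'a::nonarch_normed_field) < B" "0 < B"
  shows "vabs (sum f A) < B"
  using assms
proof (induction A rule: infinite_finite_induct)
  case (insert x A)
  then have "vabs (f x) < B" "vabs (sum f A) < B" by auto
  with insert.hyps show ?case using vabs_add_le[of "f x" "sum f A"] by simp
qed auto

lemma vabs_sum_eq:
  assumes "finite A" "k \<in> A" "\<And>i. i \<in> A \<Longrightarrow> i \<noteq> k \<Longrightarrow> vabs (f i ::'a::nonarch_normed_field) < vabs (f k)"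
    and "f k \<noteq> 0"
  shows "vabs (sum f A) = vabs (f k)"
proof -
  have "vabs (sum f (A - {k})) < vabs (f k)"
    using assms by (intro vabs_sum_less) auto
  then show ?thesis
    using assms(1,2) by (simp add: sum.remove vabs_add_eq)
qed

lemma vabs_of_nat_le: "vabs (of_nat n ::'a::nonarch_normed_field) \<le> 1"
proof (induction n)
  case (Suc n)
  then show ?case using vabs_add_le[of "1::'a" "of_nat n"] by simp
qed simp

lemma vabs_of_int_le: "vabs (of_int n ::'a::nonarch_normed_field) \<le> 1"
  by (cases n) (simp_all add: vabs_of_nat_le del: of_nat_Suc)

text \<open>A Bezout relation writes 1 as an integral combination of \<open>n\<close> and
  \<open>p\<close>; if both were small, 1 would be small.\<close>

lemma vabs_of_nat_coprime:
  assumes "vabs (of_nat p :: 'a::nonarch_normed_field) < 1" "coprime n p"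
  shows "vabs (of_nat n :: 'a) = 1"
proof (rule ccontr)
  assume "vabs (of_nat n :: 'a) \<noteq> 1"
  then have n: "vabs (of_nat n :: 'a) < 1" using vabs_of_nat_le[of n] by (metis order_le_less)
  have "coprime (int n) (int p)" using assms(2) by simp
  then obtain a b where ab: "a * int n + b * int p = 1"
    using bezout_int[of "int n" "int p"] by auto
  have "(of_int a * of_nat n + of_int b * of_nat p :: 'a) = of_int (a * int n + b * int p)"
    by simp
  then have eq: "(of_int a * of_nat n + of_int b * of_nat p :: 'a) = 1"
    using ab by simp
  have "vabs (of_int a * of_nat n :: 'a) < 1" "vabs (of_int b * of_nat p :: 'a) < 1"
    using n assms(1) mult_left_le_one_le[OF vabs_nonneg vabs_nonneg vabs_of_int_le]
    by (metis order_le_less_trans vabs_mult)+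
  with vabs_add_le[of "of_int a * of_nat n :: 'a" "of_int b * of_nat p"] eq show False by simp
qed

text \<open>Legendre's formula gives \<open>v\<^sub>p(k!) \<le> k / (p - 1)\<close>.\<close>

lemma vabs_fact_ge:
  fixes \<rho> :: real
  assumes p: "prime p" "vabs (of_nat p :: 'a::nonarch_normed_field) = 1 / real p"
    and \<rho>: "0 < \<rho>" "\<rho> ^ (p - 1) = 1 / real p"
  shows "\<rho> ^ k \<le> vabs (fact k :: 'a)"
proof -
  have p2: "p \<ge> 2" using p(1) by (rule prime_ge_2_nat)
  have p1: "vabs (of_nat p :: 'a) < 1" using p2 p(2) by simp
  \<comment> \<open>Only multiples of \<open>p\<close> contribute to the factorial, and those up to
    \<open>k\<close> are \<open>p\<close> times the numbers up to \<open>k div p\<close>.\<close>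
  have rec: "vabs (fact k :: 'a) = (1 / real p) ^ (k div p) * vabs (fact (k div p) :: 'a)" for k
  proof (induction k)
    case (Suc k)
    show ?case
    proof (cases "p dvd Suc k")
      case True
      then have d: "Suc k div p = Suc (k div p)" by (simp add: div_Suc)
      have "Suc k = p * Suc (k div p)" using True d by (metis dvd_mult_div_cancel)
      then have "vabs (of_nat (Suc k) :: 'a) = 1 / real p * vabs (of_nat (Suc (k div p)) :: 'a)"
        by (metis of_nat_mult vabs_mult p(2))
      then show ?thesis unfolding d using Suc
        by (simp add: vabs_mult del: of_nat_Suc)
    next
      case False
      then have d: "Suc k div p = k div p" by (simp add: div_Suc dvd_eq_mod_eq_0)
      have "coprime (Suc k) p"
        using False p(1) by (metis coprime_commute prime_imp_coprime)
      then have "vabs (of_nat (Suc k) :: 'a) = 1" by (rule vabs_of_nat_coprime[OF p1])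
      then show ?thesis unfolding d using Suc
        by (simp add: vabs_mult del: of_nat_Suc)
    qed
  qed simp
  have \<rho>1: "\<rho> \<le> 1"
  proof (rule ccontr)
    assume "\<not> \<rho> \<le> 1"
    then have "1 < \<rho> ^ (p - 1)" using p2 by (intro one_less_power) auto
    with \<rho>(2) p2 show False by simp
  qed
  show ?thesis
  proof (induction k rule: less_induct)
    case (less k)
    show ?case
    proof (cases "k = 0")
      case False
      have kp: "(p - 1) * (k div p) + k div p \<le> k"
        using p2 by (simp add: algebra_simps diff_mult_distrib2)
      have "\<rho> ^ k \<le> \<rho> ^ ((p - 1) * (k div p) + k div p)"
        using kp \<rho>1 \<rho>(1) by (intro power_decreasing) auto
      also have "\<dots> = (1 / real p) ^ (k div p) * \<rho> ^ (k div p)"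
        by (simp only: power_add power_mult \<rho>(2))
      also have "\<dots> \<le> (1 / real p) ^ (k div p) * vabs (fact (k div p) :: 'a)"
        using False p2 by (intro mult_left_mono less) auto
      finally show ?thesis by (simp only: rec[of k])
    qed simp
  qed
qed

section \<open>Gauss norms of power series\<close>

definition gauss_le :: "'a::nonarch_normed_field fps \<Rightarrow> real \<Rightarrow> real \<Rightarrow> bool" where
  "gauss_le f r \<mu> \<longleftrightarrow> (\<forall>n. vabs (f $ n) * r ^ n \<le> \<mu>)"

text \<open>The Gauss norm for the radius \<open>r\<close> is \<open>\<mu>\<close>, and \<open>N\<close> is the least index where it is attained.
  Keeping track of this index makes Gauss norms multiplicative, and compatible with composition,
  without assumptions on convergence.\<close>

definition gauss_at :: "'a::nonarch_normed_field fps \<Rightarrow> real \<Rightarrow> nat \<Rightarrow> real \<Rightarrow> bool" where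
  "gauss_at f r N \<mu> \<longleftrightarrow>
     gauss_le f r \<mu> \<and> vabs (f $ N) * r ^ N = \<mu> \<and> (\<forall>n<N. vabs (f $ n) * r ^ n < \<mu>)"

lemma gauss_at_imp_le: "gauss_at f r N \<mu> \<Longrightarrow> gauss_le f r \<mu>"
  by (simp add: gauss_at_def)

lemma gauss_at_unique: "gauss_at f r N \<mu> \<Longrightarrow> gauss_at f r N' \<mu>' \<Longrightarrow> \<mu> = \<mu>'"
  unfolding gauss_at_def gauss_le_def by (metis order_antisym)

lemma vabs_prod_weighted:
  fixes a b :: "'a::nonarch_normed_field"
  shows "vabs (a * b) * (r::real) ^ (i + j) = (vabs a * r ^ i) * (vabs b * r ^ j)"
  by (simp add: vabs_mult power_add mult_ac)

lemma vabs_sum_weighted_le: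
  fixes h :: "'b \<Rightarrow> 'a::nonarch_normed_field"
  assumes "0 < r" "0 \<le> \<mu>" "\<And>i. i \<in> A \<Longrightarrow> vabs (h i) * r ^ n \<le> \<mu>"
  shows "vabs (sum h A) * r ^ n \<le> \<mu>"
proof -
  have "vabs (sum h A) \<le> \<mu> / r ^ n"
    using assms by (intro vabs_sum_le) (auto simp: pos_le_divide_eq)
  then show ?thesis using assms(1) by (simp add: pos_le_divide_eq)
qed

lemma vabs_sum_weighted_less:
  fixes h :: "'b \<Rightarrow> 'a::nonarch_normed_field"
  assumes "0 < r" "0 < \<mu>" "\<And>i. i \<in> A \<Longrightarrow> vabs (h i) * r ^ n < \<mu>"
  shows "vabs (sum h A) * r ^ n < \<mu>"
proof -
  have "vabs (sum h A) < \<mu> / r ^ n"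
    using assms by (intro vabs_sum_less) (auto simp: pos_less_divide_eq)
  then show ?thesis using assms(1) by (simp add: pos_less_divide_eq)
qed

lemma vabs_sum_weighted_eq:
  fixes h :: "'b \<Rightarrow> 'a::nonarch_normed_field"
  assumes "0 < r" "0 < \<mu>" "finite A" "k \<in> A" "vabs (h k) * r ^ n = \<mu>"
    and "\<And>i. i \<in> A \<Longrightarrow> i \<noteq> k \<Longrightarrow> vabs (h i) * r ^ n < \<mu>"
  shows "vabs (sum h A) * r ^ n = \<mu>"
proof -
  have "vabs (h i) < vabs (h k)" if "i \<in> A" "i \<noteq> k" for i
    using assms(6)[OF that] assms(1) unfolding assms(5)[symmetric] by simp
  moreover have "h k \<noteq> 0" using assms(2,5) by auto
  ultimately have "vabs (sum h A) = vabs (h k)"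
    using assms(3,4) by (intro vabs_sum_eq) auto
  then show ?thesis using assms(5) by simp
qed

lemma gauss_le_mult:
  assumes "gauss_le f r \<mu>" "gauss_le g r \<nu>" "0 < r"
  shows "gauss_le (f * g) r (\<mu> * \<nu>)"
  unfolding gauss_le_def fps_mult_nth
proof
  fix n
  have \<mu>: "0 \<le> \<mu>" "0 \<le> \<nu>"
    using assms(1,2) unfolding gauss_le_def by (metis power_0 mult_1_right vabs_nonneg order_trans)+
  show "vabs (\<Sum>i = 0..n. f $ i * g $ (n - i)) * r ^ n \<le> \<mu> * \<nu>"
  proof (rule vabs_sum_weighted_le)
    fix i assume "i \<in> {0..n}"
    then have "vabs (f $ i * g $ (n - i)) * r ^ n = (vabs (f $ i) * r ^ i) * (vabs (g $ (n - i)) * r ^ (n - i))"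
      using vabs_prod_weighted[of "f $ i" "g $ (n - i)" r i "n - i"] by simp
    also have "\<dots> \<le> \<mu> * \<nu>"
      using assms \<mu> unfolding gauss_le_def by (intro mult_mono) auto
    finally show "vabs (f $ i * g $ (n - i)) * r ^ n \<le> \<mu> * \<nu>" .
  qed (use assms \<mu> in auto)
qed

lemma gauss_le_one: "0 < r \<Longrightarrow> gauss_le 1 r 1"
  by (auto simp: gauss_le_def fps_one_nth)

lemma gauss_le_power:
  assumes "gauss_le f r \<mu>" "0 < r"
  shows "gauss_le (f ^ k) r (\<mu> ^ k)"
  by (induction k) (use assms gauss_le_mult gauss_le_one in auto)

lemma gauss_le_add:
  assumes "gauss_le f r \<mu>" "gauss_le g r \<mu>" "0 < r"
  shows "gauss_le (f + g) r \<mu>"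
  unfolding gauss_le_def
proof
  fix n
  have "vabs ((f + g) $ n) * r ^ n \<le> max (vabs (f $ n)) (vabs (g $ n)) * r ^ n"
    using assms(3) vabs_add_le[of "f $ n" "g $ n"] by (intro mult_right_mono) auto
  also have "\<dots> \<le> \<mu>" using assms(1,2) by (simp add: gauss_le_def max_def)
  finally show "vabs ((f + g) $ n) * r ^ n \<le> \<mu>" .
qed

lemma gauss_le_mono: "gauss_le f r \<mu> \<Longrightarrow> \<mu> \<le> \<nu> \<Longrightarrow> gauss_le f r \<nu>"
  unfolding gauss_le_def using order_trans by blast

lemma mult_strict_le:
  fixes a b \<mu> \<nu> :: real
  assumes "a < \<mu>" "b \<le> \<nu>" "0 \<le> a" "0 < \<nu>"
  shows "a * b < \<mu> * \<nu>"
  using mult_left_mono[OF assms(2,3)] mult_strict_right_mono[OF assms(1,4)] by linarith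

text \<open>The argument of Gauss's lemma: in the coefficient of index \<open>N + N'\<close>, every
  product except one involves an index below \<open>N\<close> or below \<open>N'\<close> and is
  strictly smaller, so nothing can cancel the remaining one.\<close>

lemma gauss_at_mult:
  assumes f: "gauss_at f r N \<mu>" and g: "gauss_at g r N' \<nu>" and pos: "0 < r" "0 < \<mu>" "0 < \<nu>"
  shows "gauss_at (f * g) r (N + N') (\<mu> * \<nu>)"
proof -
  have split: "vabs (f $ i * g $ (n - i)) * r ^ n = (vabs (f $ i) * r ^ i) * (vabs (g $ (n - i)) * r ^ (n - i))"
    if "i \<le> n" for i n
    using that vabs_prod_weighted[of "f $ i" "g $ (n - i)" r i "n - i"] by simp
  have less: "vabs (f $ i * g $ (n - i)) * r ^ n < \<mu> * \<nu>" if "i \<le> n" "i < N \<or> n - i < N'" for i n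
    unfolding split[OF that(1)]
    using that(2)
  proof
    assume "i < N"
    then show "(vabs (f $ i) * r ^ i) * (vabs (g $ (n - i)) * r ^ (n - i)) < \<mu> * \<nu>"
      using f g pos unfolding gauss_at_def gauss_le_def
      by (intro mult_strict_le) auto
  next
    assume "n - i < N'"
    then show "(vabs (f $ i) * r ^ i) * (vabs (g $ (n - i)) * r ^ (n - i)) < \<mu> * \<nu>"
      using f g pos unfolding gauss_at_def gauss_le_def
      by (subst (1 2) mult.commute, intro mult_strict_le) auto
  qed
  show ?thesis
    unfolding gauss_at_def
  proof (intro conjI allI impI)
    show "gauss_le (f * g) r (\<mu> * \<nu>)"
      using f g pos(1) by (intro gauss_le_mult) (auto simp: gauss_at_def)
    show "vabs ((f * g) $ (N + N')) * r ^ (N + N') = \<mu> * \<nu>"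
      unfolding fps_mult_nth
    proof (rule vabs_sum_weighted_eq[where k = N])
      show "vabs (f $ N * g $ (N + N' - N)) * r ^ (N + N') = \<mu> * \<nu>"
        using f g by (subst split) (auto simp: gauss_at_def)
      fix i assume "i \<in> {0..N + N'}" "i \<noteq> N"
      then show "vabs (f $ i * g $ (N + N' - i)) * r ^ (N + N') < \<mu> * \<nu>"
        by (intro less) auto
    qed (use pos in auto)
    fix n assume "n < N + N'"
    then show "vabs ((f * g) $ n) * r ^ n < \<mu> * \<nu>"
      unfolding fps_mult_nth using pos
      by (intro vabs_sum_weighted_less less) auto
  qed
qed

lemma gauss_at_one: "0 < r \<Longrightarrow> gauss_at 1 r 0 1"
  by (simp add: gauss_at_def gauss_le_one)

lemma gauss_at_power:
  assumes "gauss_at f r N \<mu>" "0 < r" "0 < \<mu>"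
  shows "gauss_at (f ^ k) r (k * N) (\<mu> ^ k)"
proof (induction k)
  case (Suc k)
  then show ?case using gauss_at_mult[OF assms(1) Suc] assms by simp
qed (simp add: gauss_at_one assms)

text \<open>\<open>g ^ i\<close> attains its norm \<open>s ^ i\<close> first at index
  \<open>i * N\<close>. At index \<open>K * N\<close> the terms with \<open>i < K\<close> are small
  because \<open>K\<close> is the least index for \<open>f\<close>, and those with
  \<open>i > K\<close> because \<open>g ^ i\<close> has not yet reached its norm there.\<close>

lemma gauss_at_compose:
  assumes f: "gauss_at f s K \<mu>" and g: "gauss_at g r N s" and pos: "0 < r" "0 < s" "0 < \<mu>"
    and g0: "g $ 0 = 0"
  shows "gauss_at (f oo g) r (K * N) \<mu>"
proof -
  \<comment> \<open>Positivity of \<open>N\<close> separates the indices \<open>i * N\<close> and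
    keeps \<open>K\<close> within the range of summation up to \<open>K * N\<close>.\<close>
  have N: "N > 0" using g g0 pos(2) by (cases N) (auto simp: gauss_at_def)
  have gi: "gauss_at (g ^ i) r (i * N) (s ^ i)" for i
    using g pos by (intro gauss_at_power)
  have split: "vabs (f $ i * (g ^ i) $ n) * r ^ n = vabs (f $ i) * (vabs ((g ^ i) $ n) * r ^ n)" for i n
    by (simp add: vabs_mult)
  have le: "vabs (f $ i * (g ^ i) $ n) * r ^ n \<le> vabs (f $ i) * s ^ i" for i n
    unfolding split using gi[of i] by (intro mult_left_mono) (auto simp: gauss_at_def gauss_le_def)
  have le': "vabs (f $ i) * s ^ i \<le> \<mu>" for i
    using f by (auto simp: gauss_at_def gauss_le_def)
  have less: "vabs (f $ i * (g ^ i) $ n) * r ^ n < \<mu>" if "i < K \<or> n < i * N" for i n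
  proof (cases "i < K")
    case True
    then have "vabs (f $ i) * s ^ i < \<mu>" using f by (auto simp: gauss_at_def)
    with le[of i n] show ?thesis by simp
  next
    case False
    with that have n: "vabs ((g ^ i) $ n) * r ^ n < s ^ i"
      using gi[of i] by (auto simp: gauss_at_def)
    show ?thesis
    proof (cases "f $ i = 0")
      case False
      then have "vabs (f $ i * (g ^ i) $ n) * r ^ n < vabs (f $ i) * s ^ i"
        unfolding split using n by (intro mult_strict_left_mono) auto
      with le'[of i] show ?thesis by simp
    qed (simp add: pos)
  qed
  show ?thesis
    unfolding gauss_at_def
  proof (intro conjI allI impI)
    show "gauss_le (f oo g) r \<mu>"
      unfolding gauss_le_def fps_compose_nth using pos le le'
      by (intro allI vabs_sum_weighted_le) (auto intro: order_trans)
    show "vabs ((f oo g) $ (K * N)) * r ^ (K * N) = \<mu>"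
      unfolding fps_compose_nth
    proof (rule vabs_sum_weighted_eq[where k = K])
      show "vabs (f $ K * (g ^ K) $ (K * N)) * r ^ (K * N) = \<mu>"
        using f gi[of K] unfolding split by (auto simp: gauss_at_def)
      fix i assume "i \<noteq> K"
      then show "vabs (f $ i * (g ^ i) $ (K * N)) * r ^ (K * N) < \<mu>"
        using N by (intro less) auto
    qed (use pos N in auto)
    fix n assume n: "n < K * N"
    show "vabs ((f oo g) $ n) * r ^ n < \<mu>"
      unfolding fps_compose_nth
    proof (rule vabs_sum_weighted_less)
      fix i
      have "i < K \<or> n < i * N"
        using n by (metis leI less_le_trans mult_le_mono1)
      then show "vabs (f $ i * (g ^ i) $ n) * r ^ n < \<mu>" by (rule less)
    qed (use pos in auto)
  qed
qed

text \<open>For integral coefficients and \<open>r < 1\<close> the weighted terms tend to 0, so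
  their supremum is a maximum over finitely many indices.\<close>

lemma gauss_at_exists:
  assumes int: "\<And>n. vabs (f $ n) \<le> 1" and "f \<noteq> 0" and r: "0 < r" "r < 1"
  obtains N \<mu> where "gauss_at f r N \<mu>" "0 < \<mu>"
proof -
  obtain k where k: "f $ k \<noteq> 0" using \<open>f \<noteq> 0\<close> by (auto simp: fps_eq_iff)
  define B where "B = vabs (f $ k) * r ^ k"
  have B: "B > 0" using k r by (simp add: B_def)
  have "(\<lambda>n. r ^ n) \<longlonglongrightarrow> 0" using r by (intro LIMSEQ_realpow_zero) auto
  then have "eventually (\<lambda>n. r ^ n < B) sequentially" using B by (rule order_tendstoD)
  then obtain n0 where n0: "\<And>n. n \<ge> n0 \<Longrightarrow> r ^ n < B" by (auto simp: eventually_sequentially)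
  define w where "w = (\<lambda>n. vabs (f $ n) * r ^ n)"
  define \<mu> where "\<mu> = Max (w ` {..max n0 k})"
  have mu: "\<mu> \<in> w ` {..max n0 k}" unfolding \<mu>_def by (intro Max_in) auto
  have le: "w n \<le> \<mu>" if "n \<le> max n0 k" for n
    unfolding \<mu>_def using that by (intro Max_ge) auto
  have B\<mu>: "B \<le> \<mu>" using le[of k] by (simp add: w_def B_def)
  have le: "w n \<le> \<mu>" for n
  proof (cases "n \<le> max n0 k")
    case False
    then have "w n \<le> r ^ n" using int[of n] r by (simp add: w_def mult_left_le_one_le)
    with False n0[of n] B\<mu> show ?thesis by linarith
  qed (rule le)
  define N where "N = (LEAST n. w n = \<mu>)"
  obtain n1 where "w n1 = \<mu>" using mu by (metis imageE)
  then have N: "w N = \<mu>" unfolding N_def by (rule LeastI)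
  have "w n < \<mu>" if "n < N" for n
    using le[of n] not_less_Least[OF that[unfolded N_def]] by (rule order_le_neq_trans)
  with N le have "gauss_at f r N \<mu>" by (simp add: gauss_at_def gauss_le_def w_def)
  then show ?thesis using that B B\<mu> by auto
qed

text \<open>The shape shared by \<open>[\<pi>](Z)\<close> and \<open>(1 + Z)^p - 1\<close>.\<close>

lemma gauss_at_frobenius_like:
  assumes f: "f $ 0 = 0" "vabs (f $ 1) = c" "vabs (f $ Q) = 1" "\<And>n. n \<noteq> Q \<Longrightarrow> vabs (f $ n) \<le> c"
    and Q: "Q \<ge> 2" and r: "0 < r" "r < 1" and c: "0 < c"
  obtains N where "gauss_at f r N (max (r ^ Q) (c * r))"
proof -
  have le: "vabs (f $ n) * r ^ n \<le> c * r" if "n \<noteq> Q" for n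
  proof (cases "n = 0")
    case False
    have "vabs (f $ n) * r ^ n \<le> c * r ^ n" using f(4)[OF that] r by simp
    also have "r ^ n \<le> r ^ 1" using False r by (intro power_decreasing) auto
    finally show ?thesis using c by simp
  qed (use f c r in simp)
  have strict: "r ^ n < r" if "n \<ge> 2" for n
    using power_strict_decreasing[of 1 n r] that r by simp
  show ?thesis
  proof (cases "r ^ Q \<le> c * r")
    case True
    have "vabs (f $ n) * r ^ n \<le> c * r" for n using le[of n] True f(3) by (cases "n = Q") auto
    moreover have "max (r ^ Q) (c * r) = c * r" using True by simp
    \<comment> \<open>This case includes a tie between the two terms; the least index is then 1 and
      not \<open>Q\<close>.\<close>
    ultimately have "gauss_at f r 1 (max (r ^ Q) (c * r))"
      using f(1,2) r c unfolding gauss_at_def gauss_le_def by simp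
    then show ?thesis by (rule that)
  next
    case False
    have "vabs (f $ n) * r ^ n < r ^ Q" if "n < Q" for n using le[of n] that False by auto
    moreover have "vabs (f $ n) * r ^ n \<le> r ^ Q" for n using le[of n] False f(3) by (cases "n = Q") auto
    ultimately have "gauss_at f r Q (max (r ^ Q) (c * r))"
      using False f(3) unfolding gauss_at_def gauss_le_def by (auto simp: max_def)
    then show ?thesis by (rule that)
  qed
qed

text \<open>The coefficient of \<open>Z^(q i)\<close> in \<open>f(Z^q + k(Z))\<close> is \<open>f $ i\<close> plus terms in which powers of \<open>k\<close>
  gain a factor \<open>\<kappa>\<close>; iterating, any bound on the growth of \<open>f\<close> improves to integrality.\<close>

lemma integral_of_compose:
  fixes f k :: "'a::nonarch_normed_field fps"
  assumes g: "g = fps_X ^ q + k" and q: "q \<ge> 1"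
    and kint: "gauss_le k 1 1" and k: "gauss_le k r (\<kappa> * r ^ q)" and r: "0 < r"
    and \<kappa>: "0 \<le> \<kappa>" "\<kappa> < 1"
    and f: "\<And>i. vabs (f $ i) * (r ^ q) ^ i \<le> 1"
    and fg: "\<And>n. vabs ((f oo g) $ n) \<le> 1"
  shows "vabs (f $ i) \<le> 1"
proof -
  have X: "gauss_le (fps_X ^ q) s (s ^ q)" if "0 < s" for s :: real
    using that by (auto simp: gauss_le_def fps_X_power_nth)
  have gr: "gauss_le g r (r ^ q)"
    unfolding g using k X[of r] r \<kappa>
    by (intro gauss_le_add gauss_le_mono[OF k]) (auto intro: mult_left_le_one_le)
  have g1: "gauss_le g 1 1"
    unfolding g using kint X[of 1] by (intro gauss_le_add) auto
  \<comment> \<open>The deviation of \<open>g ^ j\<close> from its leading monomial; on the circle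
    of radius \<open>r\<close> it is smaller than \<open>g ^ j\<close> by the factor
    \<kappa>.\<close>
  define D where "D = (\<lambda>j. g ^ j - fps_X ^ (q * j))"
  have D_Suc: "D (Suc j) = g * D j + fps_X ^ (q * j) * k" for j
    by (simp add: D_def g algebra_simps power_add)
  have Xj: "gauss_le (fps_X ^ (q * j) :: 'a fps) s ((s ^ q) ^ j)" if "0 < s" for s :: real and j
    using that by (auto simp: gauss_le_def fps_X_power_nth simp flip: power_mult)
  have D1: "gauss_le (D j) 1 1" for j
  proof (induction j)
    case (Suc j)
    then show ?case unfolding D_Suc
      using gauss_le_mult[OF g1 Suc] gauss_le_mult[OF Xj[of 1 j] kint] by (intro gauss_le_add) auto
  qed (simp add: D_def gauss_le_def)
  have Dr: "gauss_le (D j) r (\<kappa> * (r ^ q) ^ j)" for j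
  proof (induction j)
    case (Suc j)
    then show ?case unfolding D_Suc
      using gauss_le_mult[OF gr Suc] gauss_le_mult[OF Xj[of r j] k] r
      by (intro gauss_le_add) (auto simp: mult_ac)
  qed (use \<kappa> in \<open>simp add: D_def gauss_le_def\<close>)
  \<comment> \<open>Each round solves for \<open>f $ i\<close> in the coefficient of index
    \<open>q * i\<close> of \<open>f oo g\<close>. The factor
    \<open>\<kappa> * (r ^ q) ^ j / (r ^ q) ^ i\<close> from \<open>D j\<close> turns the bound on
    \<open>f $ j\<close> with exponent \<open>m\<close> into the bound on \<open>f $ i\<close> with
    exponent \<open>m + 1\<close>.\<close>
  have bound: "vabs (f $ i) \<le> max 1 (\<kappa> ^ m / (r ^ q) ^ i)" for m i
  proof (induction m arbitrary: i)
    case 0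
    then show ?case using f[of i] r by (simp add: le_max_iff_disj pos_le_divide_eq)
  next
    case (Suc m)
    define M where "M = max 1 (\<kappa> ^ Suc m / (r ^ q) ^ i)"
    have tm: "vabs (f $ j * D j $ (q * i)) \<le> M" for j
    proof (cases "\<kappa> ^ m / (r ^ q) ^ j \<le> 1")
      case True
      then have "vabs (f $ j) \<le> 1" using Suc[of j] by simp
      moreover have "vabs (D j $ (q * i)) \<le> 1" using D1[of j] by (simp add: gauss_le_def)
      ultimately have "vabs (f $ j * D j $ (q * i)) \<le> 1" by (simp add: vabs_mult mult_le_one)
      then show ?thesis by (simp add: M_def)
    next
      case False
      have "vabs (D j $ (q * i)) * (r ^ q) ^ i \<le> \<kappa> * (r ^ q) ^ j"
        using Dr[of j, unfolded gauss_le_def, rule_format, of "q * i"] by (simp add: power_mult)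
      then have "vabs (D j $ (q * i)) \<le> \<kappa> * (r ^ q) ^ j / (r ^ q) ^ i"
        using r by (simp add: pos_le_divide_eq)
      moreover have "vabs (f $ j) \<le> \<kappa> ^ m / (r ^ q) ^ j" using Suc[of j] False by simp
      ultimately have "vabs (f $ j) * vabs (D j $ (q * i)) \<le>
          \<kappa> ^ m / (r ^ q) ^ j * (\<kappa> * (r ^ q) ^ j / (r ^ q) ^ i)"
        using \<kappa> r by (intro mult_mono) auto
      also have "\<dots> = \<kappa> ^ Suc m / (r ^ q) ^ i" using r by simp
      finally show ?thesis by (simp add: M_def vabs_mult)
    qed
    have "(f oo g) $ (q * i) =
        (\<Sum>j = 0..q * i. f $ j * fps_X ^ (q * j) $ (q * i)) + (\<Sum>j = 0..q * i. f $ j * D j $ (q * i))"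
      by (simp add: fps_compose_nth D_def algebra_simps flip: sum.distrib)
    also have "(\<Sum>j = 0..q * i. f $ j * fps_X ^ (q * j) $ (q * i)) = (\<Sum>j = 0..q * i. if j = i then f $ i else 0)"
      using q by (intro sum.cong) (auto simp: fps_X_power_nth)
    also have "\<dots> = f $ i" using q by simp
    finally have "f $ i = (f oo g) $ (q * i) - (\<Sum>j = 0..q * i. f $ j * D j $ (q * i))" by simp
    moreover have "vabs (\<Sum>j = 0..q * i. f $ j * D j $ (q * i)) \<le> M"
      using tm by (intro vabs_sum_le) (auto simp: M_def)
    moreover have "vabs ((f oo g) $ (q * i)) \<le> M"
      using fg[of "q * i"] by (simp add: M_def)
    ultimately show ?case
      using vabs_diff_le[of "(f oo g) $ (q * i)" "\<Sum>j = 0..q * i. f $ j * D j $ (q * i)"]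
      unfolding M_def[symmetric] by simp
  qed
  have "(\<lambda>m. \<kappa> ^ m) \<longlonglongrightarrow> 0" using \<kappa> by (intro LIMSEQ_realpow_zero) auto
  then have "eventually (\<lambda>m. \<kappa> ^ m < (r ^ q) ^ i) sequentially"
    using r by (intro order_tendstoD) auto
  then obtain m where "\<kappa> ^ m < (r ^ q) ^ i" by (auto simp: eventually_sequentially)
  then have "\<kappa> ^ m / (r ^ q) ^ i \<le> 1" using r by simp
  with bound[of i m] show ?thesis by simp
qed

section \<open>Solving the functional equation of the valuation polygon\<close>

text \<open>The valuation of [\<pi>] at a generic point of valuation \<open>u\<close>: the terms
  \<open>Z^q\<close> and \<open>\<pi> Z\<close> compete. The corner \<open>1 / (q - 1)\<close> is
  the valuation of the nonzero \<pi>-torsion points.\<close>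

definition vstep :: "nat \<Rightarrow> real \<Rightarrow> real" where
  "vstep q u = min (real q * u) (u + 1)"

text \<open>The point carried to the corner of \<open>vstep\<close> by \<open>m\<close>
  multiplications with \<open>q\<close>. It becomes minus the slope of the edge between the vertices
  of index \<open>m\<close> and \<open>m + 1\<close>.\<close>

definition u_crit :: "nat \<Rightarrow> nat \<Rightarrow> real" where
  "u_crit q m = 1 / (real q ^ m * (real q - 1))"

lemma vstep_ge: "q \<ge> 2 \<Longrightarrow> u \<ge> 1 / (real q - 1) \<Longrightarrow> vstep q u = u + 1"
  unfolding vstep_def by (simp add: pos_divide_le_eq algebra_simps)

lemma vstep_le: "q \<ge> 2 \<Longrightarrow> u \<le> 1 / (real q - 1) \<Longrightarrow> vstep q u = real q * u"
  unfolding vstep_def by (simp add: pos_le_divide_eq algebra_simps)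

lemma vstep_pos: "q \<ge> 1 \<Longrightarrow> 0 < u \<Longrightarrow> 0 < vstep q u"
  by (simp add: vstep_def)

lemma vstep_funpow_ge:
  assumes "q \<ge> 2" "u \<ge> 1 / (real q - 1)"
  shows "(vstep q ^^ k) u = u + real k"
proof (induction k)
  case (Suc k)
  have "vstep q (u + real k) = u + real k + 1" using assms by (intro vstep_ge) auto
  with Suc show ?case by simp
qed simp

text \<open>The bound is \<open>q / (q - 1)\<close> and not \<open>1 / (q - 1)\<close>, because only
  the points before the last step must not exceed the corner.\<close>

lemma vstep_funpow_le:
  assumes "q \<ge> 2" "0 < u" "real q ^ k * u \<le> real q / (real q - 1)"
  shows "(vstep q ^^ k) u = real q ^ k * u"
  using assms(3)
proof (induction k)
  case (Suc k)
  have q: "real q \<ge> 2" using assms(1) by simp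
  have "real q * (real q ^ k * u) \<le> real q * (1 / (real q - 1))" using Suc.prems by (simp add: mult_ac)
  then have *: "real q ^ k * u \<le> 1 / (real q - 1)"
    using q by (subst (asm) mult_le_cancel_left_pos) auto
  also have "\<dots> \<le> real q / (real q - 1)" using q by (simp add: divide_right_mono)
  finally have "(vstep q ^^ k) u = real q ^ k * u" by (rule Suc.IH)
  with vstep_le[OF assms(1) *] show ?case by (simp add: mult_ac)
qed simp

section \<open>Recursions for the coordinates of the vertices\<close>

lemma x_vert_0: "e \<ge> 1 \<Longrightarrow> x_vert p e q 0 = 1"
proof -
  assume "e \<ge> 1"
  then have "\<lfloor>- (1 / real e)\<rfloor> = - 1" by (simp add: floor_eq_iff)
  then show ?thesis by (simp add: x_vert_def k_exp_def)
qed

lemma k_exp_first: "1 \<le> m \<Longrightarrow> m \<le> e \<Longrightarrow> k_exp e m = 0"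
  by (auto simp: k_exp_def floor_eq_iff field_simps)

lemma k_exp_shift:
  assumes "e \<ge> 1"
  shows "k_exp e (m + e) = k_exp e m + 1"
proof -
  have "(real (m + e) - 1) / real e = (real m - 1) / real e + 1"
    using assms by (simp add: field_simps)
  then show ?thesis by (simp add: k_exp_def)
qed

lemma x_vert_shift:
  assumes "e \<ge> 1" "p \<ge> 2"
  shows "x_vert p e q (m + e) = real q ^ e * x_vert p e q m / real p"
proof -
  have "real p powi (k_exp e m + 1 + 1) = real p powi (k_exp e m + 1) * real p"
    using assms(2) by (intro power_int_add_1) auto
  then show ?thesis by (simp add: x_vert_def k_exp_shift[OF assms(1)] power_add mult_ac)
qed

text \<open>This is the functional equation on intercepts: after \<open>m\<close> multiplications by
  \<open>q\<close>, the other \<open>e - m\<close> steps add 1 each, the line \<open>u + w\<close>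
  is evaluated, and the result is divided by \<open>p\<close>.\<close>

lemma y_vert_first:
  assumes "p \<ge> 2" "q \<ge> 2" "1 \<le> m" "m \<le> e"
  shows "y_vert p e q m = (real e - real m + y_vert p e q 0) / real p"
proof -
  have "(\<Sum>j = 1..m - 1. 1 / real p powi (k_exp e j + 1)) = (\<Sum>j = 1..m - 1. 1 / real p)"
    using assms by (intro sum.cong) (auto simp: k_exp_first)
  also have "\<dots> = (real m - 1) / real p" using assms by (simp add: of_nat_diff)
  finally have "y_vert p e q m = real e / (real p - 1) - (real m - 1) / real p - real q / (real p * (real q - 1))"
    using assms by (simp add: y_vert_def k_exp_first)
  moreover have "real p \<noteq> 0" "real p - 1 \<noteq> 0" "real q - 1 \<noteq> 0" using assms by auto
  ultimately show ?thesis
    by (simp add: y_vert_def) (simp add: divide_simps, simp add: algebra_simps)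
qed

text \<open>The counterpart when all \<open>e\<close> steps multiply by \<open>q\<close>: this
  leaves the intercept alone, and only the division by \<open>p\<close> remains.\<close>

lemma y_vert_shift:
  assumes "e \<ge> 1" "p \<ge> 2" "q \<ge> 2" "1 \<le> m"
  shows "y_vert p e q (m + e) = y_vert p e q m / real p"
proof -
  define P where "P = (\<lambda>j. 1 / real p powi (k_exp e j + 1))"
  have p: "real p \<noteq> 0" "real p - 1 \<noteq> 0" "real q - 1 \<noteq> 0" using assms by auto
  have shift: "P (j + e) = P j / real p" for j
    using assms by (simp add: P_def k_exp_shift power_int_add_1)
  have "{1..m + e - 1} = {1..e} \<union> {1 + e..m - 1 + e}" "{1..e} \<inter> {1 + e..m - 1 + e} = {}"
    using assms by auto
  then have "(\<Sum>j = 1..m + e - 1. P j) = (\<Sum>j = 1..e. P j) + (\<Sum>j = 1 + e..m - 1 + e. P j)"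
    by (simp add: sum.union_disjoint)
  also have "(\<Sum>j = 1..e. P j) = (\<Sum>j = 1..e. 1 / real p)"
    by (intro sum.cong) (auto simp: P_def k_exp_first)
  also have "\<dots> = real e / real p" by simp
  also have "(\<Sum>j = 1 + e..m - 1 + e. P j) = (\<Sum>j = 1..m - 1. P j) / real p"
    by (simp only: sum.shift_bounds_cl_nat_ivl shift sum_divide_distrib)
  finally have S: "(\<Sum>j = 1..m + e - 1. P j) = real e / real p + (\<Sum>j = 1..m - 1. P j) / real p" .
  have y: "y_vert p e q k = real e / (real p - 1) - (\<Sum>j = 1..k - 1. P j) - P k * (real q / (real q - 1))"
    if "k \<ge> 1" for k
    using that by (simp add: y_vert_def P_def)
  have "y_vert p e q (m + e) = real e / (real p - 1) - (real e / real p + (\<Sum>j = 1..m - 1. P j) / real p)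
      - P m / real p * (real q / (real q - 1))"
    using y[of "m + e"] assms S by (simp add: shift)
  \<comment> \<open>The constant terms match because \<open>e / (p - 1) - e / p\<close> is
    \<open>e / (p - 1)\<close> divided by \<open>p\<close>.\<close>
  also have "\<dots> = (real e / (real p - 1) - (\<Sum>j = 1..m - 1. P j) - P m * (real q / (real q - 1))) / real p"
    using p by (simp add: diff_divide_distrib) (simp add: divide_simps, simp add: algebra_simps)
  finally show ?thesis using y[of m] assms by simp
qed

text \<open>\<open>M u\<close> plays the role of the least valuation of the terms of a power series at points of
  valuation \<open>u\<close>; the assumption \<open>support\<close> says that it is a minimum of affine functions with integral
  slopes.\<close>

locale valuation_profile =
  fixes p e q :: nat and w :: real and M :: "real \<Rightarrow> real"
  assumes p: "p \<ge> 2" and q: "q \<ge> 2" and e: "e \<ge> 1"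
    and support: "0 < u \<Longrightarrow> \<exists>N::nat. \<forall>u'>0. M u' \<le> M u + real N * (u' - u)"
    and functional_eq: "0 < u \<Longrightarrow> min (real p * M u) (M u + real e) = M ((vstep q ^^ e) u)"
    and eventually_line: "\<exists>U. \<forall>u\<ge>U. M u = u + w"
    and w_less: "w < real e / (real p - 1) - 1 / (real q - 1) + 1"
begin

text \<open>The increasing bijection taking \<open>x\<close> to \<open>min (p * x) (x + e)\<close>
  has the inverse taking \<open>c\<close> to \<open>max (c / p) (c - e)\<close>. In this form the
  equation computes \<open>M\<close> from its values further to the right.\<close>

lemma M_step:
  assumes u: "0 < u"
  shows "M u = max (M ((vstep q ^^ e) u) / real p) (M ((vstep q ^^ e) u) - real e)"
proof (cases "real p * M u \<le> M u + real e")
  case True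
  then have "M ((vstep q ^^ e) u) = real p * M u" using functional_eq[OF u] by simp
  with True p show ?thesis by simp
next
  case False
  then have c: "M ((vstep q ^^ e) u) = M u + real e" using functional_eq[OF u] by simp
  moreover have "(M u + real e) / real p \<le> M u"
    using False p by (simp add: pos_divide_le_eq mult.commute)
  ultimately show ?thesis by simp
qed

text \<open>The slope of the supporting line at the right end point is a natural number, hence
  nonnegative.\<close>

lemma M_mono: "0 < u \<Longrightarrow> u \<le> u' \<Longrightarrow> M u \<le> M u'"
  using support[of u'] mult_nonneg_nonneg[of "real _" "u' - u"]
  by (metis add.commute add_le_same_cancel2 diff_le_0_iff_le dual_order.trans
      mult_nonneg_nonpos of_nat_0_le_iff order_less_le_trans)

lemma level_eq: "(real p - 1) * (c - real e) - real e = real p * (c - real e) - c"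
  by (simp add: algebra_simps)

text \<open>The two branches agree when their common value \<open>x\<close> satisfies
  \<open>p * x = x + e\<close>, that is, at the level \<open>e / (p - 1)\<close>.\<close>

lemma max_high:
  assumes "real e / (real p - 1) \<le> c - real e"
  shows "max (c / real p) (c - real e) = c - real e"
proof -
  have "real e \<le> (real p - 1) * (c - real e)"
    using assms p by (simp add: pos_divide_le_eq mult.commute)
  then have "c / real p \<le> c - real e"
    using level_eq[of c] p by (simp add: pos_divide_le_eq mult.commute)
  then show ?thesis by simp
qed

lemma max_low:
  assumes "c - real e \<le> real e / (real p - 1)"
  shows "max (c / real p) (c - real e) = c / real p"
proof -
  have "(real p - 1) * (c - real e) \<le> real e"
    using assms p by (simp add: pos_le_divide_eq mult.commute)
  then have "c - real e \<le> c / real p"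
    using level_eq[of c] p by (simp add: pos_le_divide_eq mult.commute)
  then show ?thesis by simp
qed

text \<open>Right of the corner, \<open>e\<close> steps translate by \<open>e\<close>, and above the
  level \<open>e / (p - 1)\<close> the branch \<open>c - e\<close> undoes this translation. So the
  line known for large \<open>u\<close> propagates to the left as long as both conditions
  hold.\<close>

lemma M_line:
  assumes u: "1 / (real q - 1) \<le> u" and uw: "real e / (real p - 1) \<le> u + w"
  shows "M u = u + w"
proof -
  obtain U where U: "\<And>u. u \<ge> U \<Longrightarrow> M u = u + w" using eventually_line by auto
  have q1: "0 < 1 / (real q - 1)" using q by simp
  \<comment> \<open>\<open>n\<close> measures the distance to the left of \<open>U\<close>; one use
    of \<open>M_step\<close> covers the distance \<open>e\<close>, which is at least 1.\<close>
  have "\<forall>u. 1 / (real q - 1) \<le> u \<longrightarrow> real e / (real p - 1) \<le> u + w \<longrightarrow> U - real n \<le> u \<longrightarrow> M u = u + w" for n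
  proof (induction n)
    case 0
    then show ?case using U by simp
  next
    case (Suc n)
    show ?case
    proof (intro allI impI)
      fix u assume u: "1 / (real q - 1) \<le> u" "real e / (real p - 1) \<le> u + w" "U - real (Suc n) \<le> u"
      have H: "(vstep q ^^ e) u = u + real e" using q u by (intro vstep_funpow_ge) auto
      have "M (u + real e) = u + real e + w"
        using Suc u e by auto
      moreover have "max ((u + real e + w) / real p) (u + real e + w - real e) = u + w"
        using max_high[of "u + real e + w"] u(2) by simp
      ultimately show "M u = u + w" using M_step[of u] q1 u(1) unfolding H by simp
    qed
  qed
  from this[of "nat \<lceil>U - u\<rceil>"] u uw show ?thesis
    by (metis diff_le_eq add.commute real_nat_ceiling_ge)
qed

text \<open>Where \<open>M\<close> crosses the level \<open>e / (p - 1)\<close>, the functional equation divides the slope by \<open>p\<close> on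
  the left, a kink of the wrong direction unless the slope of \<open>vstep\<close> changes there as well.\<close>

lemma no_convex_kink:
  assumes u: "0 < u" and \<epsilon>: "0 < \<epsilon>" "\<epsilon> < u" and a: "0 < a"
    and R: "M (u + \<epsilon>) = M u + a * \<epsilon>" and L: "M (u - \<epsilon>) = M u - a / real p * \<epsilon>"
  shows False
proof -
  obtain N :: nat where N: "\<And>u'. u' > 0 \<Longrightarrow> M u' \<le> M u + real N * (u' - u)"
    using support[OF u] by auto
  have "a * \<epsilon> \<le> real N * \<epsilon>" using N[of "u + \<epsilon>"] R u \<epsilon> by simp
  moreover have "real N * \<epsilon> \<le> a / real p * \<epsilon>" using N[of "u - \<epsilon>"] L u \<epsilon> by simp
  ultimately have "a * \<epsilon> \<le> a / real p * \<epsilon>" by linarith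
  then have "a \<le> a / real p" using \<epsilon>(1) by (rule mult_right_le_imp_le)
  then show False using a p by (simp add: field_simps)
qed

text \<open>Otherwise the line \<open>u + w\<close> meets the level \<open>e / (p - 1)\<close> right
  of the corner, where \<open>vstep\<close> is still a translation. The slope would then be 1 on the
  right and \<open>1 / p\<close> on the left.\<close>

lemma w_ge: "real e / (real p - 1) - 1 / (real q - 1) \<le> w"
proof (rule ccontr)
  assume less: "\<not> real e / (real p - 1) - 1 / (real q - 1) \<le> w"
  define u where "u = real e / (real p - 1) - w"
  \<comment> \<open>The first bound keeps \<open>u - \<epsilon>\<close> right of the corner; the
    second puts \<open>u - \<epsilon> + e\<close> where \<open>M\<close> is already known.\<close>
  define \<epsilon> where "\<epsilon> = min (u - 1 / (real q - 1)) (real e)"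
  have q1: "0 < 1 / (real q - 1)" using q by simp
  have pos: "0 < \<epsilon>" "\<epsilon> \<le> u - 1 / (real q - 1)" "\<epsilon> \<le> real e"
    using less e q1 by (auto simp: \<epsilon>_def u_def)
  then have "\<epsilon> < u" using q1 by linarith
  have line: "M v = v + w" if "v \<ge> u" for v
    using that pos q1 by (intro M_line) (auto simp: u_def)
  have H: "(vstep q ^^ e) (u - \<epsilon>) = u - \<epsilon> + real e" using q pos by (intro vstep_funpow_ge) auto
  have "M (u - \<epsilon>) = max ((u - \<epsilon> + real e + w) / real p) (u - \<epsilon> + real e + w - real e)"
    using M_step[of "u - \<epsilon>"] pos \<open>\<epsilon> < u\<close> line[of "u - \<epsilon> + real e"] unfolding H by simp
  also have "\<dots> = (u - \<epsilon> + real e + w) / real p"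
    using pos by (intro max_low) (simp add: u_def)
  also have "\<dots> = M u - 1 / real p * \<epsilon>"
    using p line[of u] by (simp add: u_def) (simp add: divide_simps, simp add: algebra_simps)
  finally show False
    using no_convex_kink[of u \<epsilon> 1] pos \<open>\<epsilon> < u\<close> line[of u] line[of "u + \<epsilon>"] q1 by simp
qed

text \<open>For \<open>w\<close> strictly between two admissible values, the level is crossed
  strictly between \<open>u_crit q 1\<close> and \<open>u_crit q 0\<close>. There one step
  multiplies by \<open>q\<close> and the others translate, so the slope would be \<open>q\<close> on
  the right and \<open>q / p\<close> on the left.\<close>

lemma w_eq: "w = real e / (real p - 1) - 1 / (real q - 1)"
proof (rule ccontr)
  define \<delta> where "\<delta> = w - (real e / (real p - 1) - 1 / (real q - 1))"
  assume "w \<noteq> real e / (real p - 1) - 1 / (real q - 1)"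
  then have \<delta>: "0 < \<delta>" "\<delta> < 1" using w_ge w_less by (auto simp: \<delta>_def)
  have q2: "real q \<ge> 2" using q by simp
  define u0 where "u0 = 1 / (real q - 1)"
  have u0: "u0 > 0" "real q * u0 = u0 + 1" using q2 by (auto simp: u0_def field_simps)
  \<comment> \<open>The solution of \<open>q * u - 1 + w = e / (p - 1)\<close>, where the level is
    crossed.\<close>
  define u where "u = u0 - \<delta> / real q"
  \<comment> \<open>The bounds keep \<open>u + \<epsilon> \<le> u0\<close> and
    \<open>q * (u - \<epsilon>) \<ge> u0\<close>, so exactly the first step multiplies.\<close>
  define \<epsilon> where "\<epsilon> = min (\<delta> / real q) ((1 - \<delta>) / real q)"
  have \<epsilon>: "0 < \<epsilon>" "\<epsilon> \<le> \<delta> / real q" "\<epsilon> \<le> (1 - \<delta>) / real q" using \<delta> q2 by (auto simp: \<epsilon>_def)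
  have qu: "real q * u = u0 + 1 - \<delta>" using u0 q2 by (simp add: u_def right_diff_distrib)
  have q\<epsilon>: "real q * \<epsilon> \<le> 1 - \<delta>" using \<epsilon>(3) q2 by (simp add: pos_le_divide_eq mult.commute)
  have "real q * (u - \<epsilon>) \<ge> u0" using qu q\<epsilon> by (simp add: right_diff_distrib)
  then have "real q * (u - \<epsilon>) > 0" using u0 by linarith
  then have pos: "u - \<epsilon> > 0" using q2 by (simp add: zero_less_mult_iff)
  have val: "M v = max ((real q * v + real e - 1 + w) / real p) (real q * v + real e - 1 + w - real e)"
    if v: "u - \<epsilon> \<le> v" "v \<le> u0" for v
  proof -
    have v0: "v > 0" using pos v by simp
    have "real q * (u - \<epsilon>) \<le> real q * v" using v q2 by (intro mult_left_mono) auto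
    then have qv: "real q * v \<ge> u0" using \<open>real q * (u - \<epsilon>) \<ge> u0\<close> by linarith
    have "(vstep q ^^ e) v = (vstep q ^^ (e - 1)) (vstep q v)"
      using e by (metis Suc_diff_1 funpow_swap1 funpow.simps(2) comp_apply less_le_trans zero_less_one)
    also have "vstep q v = real q * v" using v q unfolding u0_def by (intro vstep_le) auto
    also have "(vstep q ^^ (e - 1)) (real q * v) = real q * v + real e - 1"
      using vstep_funpow_ge[of q "real q * v" "e - 1"] q qv e unfolding u0_def by (simp add: of_nat_diff)
    finally have H: "(vstep q ^^ e) v = real q * v + real e - 1" .
    have "M (real q * v + real e - 1) = real q * v + real e - 1 + w"
      using qv e \<delta> by (intro M_line) (auto simp: u0_def \<delta>_def)
    with M_step[OF v0] show ?thesis unfolding H by simp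
  qed
  have w: "w = \<delta> + real e / (real p - 1) - u0" by (simp add: \<delta>_def u0_def)
  have big: "M v = real q * v - 1 + w" if "u \<le> v" "v \<le> u0" for v
  proof -
    have "real q * u \<le> real q * v" using that q2 by (intro mult_left_mono) auto
    then have "real e / (real p - 1) \<le> real q * v + real e - 1 + w - real e" using qu w by linarith
    then show ?thesis
      using max_high[of "real q * v + real e - 1 + w"] val[of v] that \<epsilon>(1) by simp
  qed
  have "real q * (u - \<epsilon>) \<le> real q * u" using \<epsilon> q2 by (intro mult_left_mono) auto
  then have "real q * (u - \<epsilon>) + real e - 1 + w - real e \<le> real e / (real p - 1)" using qu w by linarith
  moreover have "u \<le> u0" using \<delta> by (simp add: u_def)
  ultimately have "M (u - \<epsilon>) = (real q * (u - \<epsilon>) + real e - 1 + w) / real p"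
    using max_low[of "real q * (u - \<epsilon>) + real e - 1 + w"] val[of "u - \<epsilon>"] \<epsilon>(1) by simp
  also have "\<dots> = (real q * u + real e - 1 + w) / real p - real q / real p * \<epsilon>"
    by (simp add: right_diff_distrib diff_divide_distrib add_divide_distrib)
  also have "(real q * u + real e - 1 + w) / real p = M u"
    using big[of u] \<open>u \<le> u0\<close> qu w max_low[of "real q * u + real e - 1 + w"]
      max_high[of "real q * u + real e - 1 + w"] by simp
  finally have L: "M (u - \<epsilon>) = M u - real q / real p * \<epsilon>" .
  have "u + \<epsilon> \<le> u0" using \<epsilon> by (simp add: u_def)
  then have R: "M (u + \<epsilon>) = M u + real q * \<epsilon>"
    using big[of u] big[of "u + \<epsilon>"] \<open>u \<le> u0\<close> \<epsilon> by (simp add: algebra_simps)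
  show False using no_convex_kink[OF _ \<epsilon>(1) _ _ R L] pos \<epsilon>(1) q2 by simp
qed

lemma w_y_vert: "w = y_vert p e q 0"
  by (simp add: w_eq y_vert_def)

lemma M_segment_0: "u_crit q 0 \<le> u \<Longrightarrow> M u = x_vert p e q 0 * u + y_vert p e q 0"
  using M_line[of u] w_eq x_vert_0[OF e, of p q] w_y_vert by (simp add: u_crit_def)

text \<open>For \<open>m \<le> e\<close> the orbit of \<open>u\<close> passes the corner after
  \<open>m\<close> steps and ends on the line \<open>u + w\<close>; for \<open>m > e\<close> all
  \<open>e\<close> steps multiply by \<open>q\<close> and lead to the segment of index
  \<open>m - e\<close>. In both cases the branch \<open>c / p\<close> applies.\<close>

lemma M_segment:
  assumes "m \<ge> 1" "u_crit q m \<le> u" "u \<le> u_crit q (m - 1)"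
  shows "M u = x_vert p e q m * u + y_vert p e q m"
  using assms
proof (induction m arbitrary: u rule: less_induct)
  case (less m)
  have q2: "real q \<ge> 2" using q by simp
  have "u_crit q m > 0" using q2 by (simp add: u_crit_def)
  then have u: "u > 0" using less.prems by simp
  have lo: "1 / (real q - 1) \<le> real q ^ m * u"
    using less.prems(2) q2 by (simp add: u_crit_def pos_divide_le_eq mult_ac)
  have hi: "real q ^ (m - 1) * u \<le> 1 / (real q - 1)"
    using less.prems(3) q2 by (simp add: u_crit_def pos_le_divide_eq mult_ac)
  have qm: "real q ^ m * u = real q * (real q ^ (m - 1) * u)"
    using less.prems(1) by (cases m) auto
  have hi': "real q ^ m * u \<le> real q / (real q - 1)"
    unfolding qm using hi q2 mult_left_mono[OF hi, of "real q"] by simp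
  have low: "M u = c / real p" if "c = M ((vstep q ^^ e) u)" "c - real e \<le> real e / (real p - 1)" for c
    using max_low[OF that(2)] that(1) M_step[OF u] by simp
  show ?case
  proof (cases "m \<le> e")
    case True
    have "(vstep q ^^ e) u = (vstep q ^^ (e - m)) ((vstep q ^^ m) u)"
      using True by (metis comp_apply funpow_add le_add_diff_inverse2)
    also have "(vstep q ^^ m) u = real q ^ m * u" using q u hi' by (rule vstep_funpow_le)
    also have "(vstep q ^^ (e - m)) (real q ^ m * u) = real q ^ m * u + (real e - real m)"
      using vstep_funpow_ge[OF q lo, of "e - m"] True by (simp add: of_nat_diff)
    finally have H: "(vstep q ^^ e) u = real q ^ m * u + (real e - real m)" .
    define c where "c = real q ^ m * u + (real e - real m) + w"
    have "c = M ((vstep q ^^ e) u)"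
      unfolding H c_def using lo True w_eq by (intro M_line[symmetric]) auto
    moreover have "real q / (real q - 1) = 1 + 1 / (real q - 1)" using q2 by (simp add: field_simps)
    then have "c - real e \<le> real e / (real p - 1)"
      using hi' w_eq less.prems(1) unfolding c_def by simp
    ultimately have "M u = c / real p" by (rule low)
    also have "\<dots> = x_vert p e q m * u + y_vert p e q m"
      using y_vert_first[OF p q less.prems(1) True] k_exp_first[OF less.prems(1) True]
      by (simp add: c_def x_vert_def w_y_vert add_divide_distrib)
    finally show ?thesis .
  next
    case False
    define n where "n = m - e"
    have n: "m = n + e" "n \<ge> 1" "n < m" using False e by (auto simp: n_def)
    have "real q ^ e * u \<le> real q ^ (m - 1) * u"
      using False q2 u by (intro mult_right_mono power_increasing) auto
    with hi have qe: "real q ^ e * u \<le> 1 / (real q - 1)" by linarith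
    also have "\<dots> \<le> real q / (real q - 1)" using q2 by (simp add: divide_right_mono)
    finally have H: "(vstep q ^^ e) u = real q ^ e * u" using q u by (intro vstep_funpow_le)
    define c where "c = x_vert p e q n * (real q ^ e * u) + y_vert p e q n"
    have pos: "real q ^ e * u > 0" using u q2 by simp
    have "M (real q ^ e * u) = c" unfolding c_def
    proof (rule less.IH)
      show "u_crit q n \<le> real q ^ e * u"
        using lo q2 unfolding u_crit_def n(1) by (simp add: power_add pos_divide_le_eq mult_ac)
      have "m - 1 = n - 1 + e" using n by simp
      then show "real q ^ e * u \<le> u_crit q (n - 1)"
        using hi q2 unfolding u_crit_def by (simp add: power_add pos_le_divide_eq mult_ac)
    qed (use n in auto)
    then have c: "c = M ((vstep q ^^ e) u)" by (simp add: H)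
    \<comment> \<open>The value of \<open>M\<close> at the corner is exactly the level at which the
      branches switch.\<close>
    also have "\<dots> \<le> M (1 / (real q - 1))" unfolding H using qe pos by (rule M_mono[rotated])
    also have "\<dots> = real e / (real p - 1)" using M_line[of "1 / (real q - 1)"] w_eq by simp
    finally have "c - real e \<le> real e / (real p - 1)" by simp
    with c have "M u = c / real p" by (rule low)
    also have "\<dots> = x_vert p e q m * u + y_vert p e q m"
      unfolding n(1) x_vert_shift[OF e p] y_vert_shift[OF e p q n(2)] by (simp add: c_def add_divide_distrib mult_ac)
    finally show ?thesis .
  qed
qed

end

section \<open>Vertices of Newton polygons\<close>

lemma newton_region_halfplane:
  fixes f :: "'a::zero fps" and s :: real
  assumes "\<And>n. ereal (c - real n * s) \<le> v (f $ n)" and "z \<in> newton_region v f"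
  shows "c \<le> snd z + fst z * s"
proof -
  have "newton_region v f \<subseteq> {z. (s, 1) \<bullet> z \<ge> c}"
    unfolding newton_region_def
  proof (rule hull_minimal)
    show "convex {z. (s, 1::real) \<bullet> z \<ge> c}" by (rule convex_halfspace_ge)
    show "{(real n, y) |n y. v (f $ n) \<le> ereal y} \<subseteq> {z. (s, 1) \<bullet> z \<ge> c}"
    proof safe
      fix n y assume "v (f $ n) \<le> ereal y"
      with assms(1)[of n] have "ereal (c - real n * s) \<le> ereal y" by (rule order_trans)
      then show "c \<le> (s, 1) \<bullet> (real n, y)" by (simp add: inner_prod_def mult.commute)
    qed
  qed
  with assms(2) have "(s, 1) \<bullet> z \<ge> c" by blast
  then show ?thesis by (cases z) (simp add: inner_prod_def mult.commute add.commute)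
qed

lemma newton_region_generator: "v (f $ n) \<le> ereal y \<Longrightarrow> (real n, y) \<in> newton_region v f"
  unfolding newton_region_def by (rule hull_inc) auto

lemma newton_region_up:
  assumes "(a, c) \<in> newton_region v f" "0 \<le> t"
  shows "(a, c + t) \<in> newton_region v f"
proof -
  define G where "G = {(real n, y) |n y. v (f $ n) \<le> ereal y}"
  have "convex hull G \<subseteq> {z. z + (0, t) \<in> convex hull G}"
  proof (rule hull_minimal)
    show "convex {z. z + (0, t) \<in> convex hull G}"
    proof (rule convexI, unfold mem_Collect_eq)
      fix a b :: "real \<times> real" and u v :: real
      assume ab: "a + (0, t) \<in> convex hull G" "b + (0, t) \<in> convex hull G"
        and uv: "0 \<le> u" "0 \<le> v" "u + v = 1"
      have "u *\<^sub>R (a + (0, t)) + v *\<^sub>R (b + (0, t)) = (u *\<^sub>R a + v *\<^sub>R b) + (u + v) *\<^sub>R (0, t)"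
        by (simp only: scaleR_add_right scaleR_add_left) simp
      then have "u *\<^sub>R a + v *\<^sub>R b + (0, t) = u *\<^sub>R (a + (0, t)) + v *\<^sub>R (b + (0, t))"
        using uv(3) by simp
      also have "\<dots> \<in> convex hull G" using convex_convex_hull ab uv by (rule convexD)
      finally show "u *\<^sub>R a + v *\<^sub>R b + (0, t) \<in> convex hull G" .
    qed
    have "(n, y + t) \<in> G" if "(n, y) \<in> G" for n y
      using that assms(2) unfolding G_def by (auto elim!: order_trans)
    then show "G \<subseteq> {z. z + (0, t) \<in> convex hull G}" by (auto intro!: hull_inc)
  qed
  with assms(1) show ?thesis unfolding newton_region_def G_def[symmetric] by auto
qed

text \<open>Two supporting lines, of slopes \<open>-s\<close> and \<open>-t\<close>, pass through
  the point. A segment of the region with the point in its interior would lie on both lines, hence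
  be trivial.\<close>

lemma newton_vertexI:
  fixes f :: "'a::zero fps" and s t x y :: real
  assumes s: "\<And>n. ereal (y + x * s - real n * s) \<le> v (f $ n)"
    and t: "\<And>n. ereal (y + x * t - real n * t) \<le> v (f $ n)"
    and st: "s \<noteq> t" and n: "x = real n" "v (f $ n) \<le> ereal y"
  shows "(x, y) \<in> newton_vertices v f"
proof -
  have "(x, y) \<notin> open_segment a b" if "a \<in> newton_region v f" "b \<in> newton_region v f" for a b
  proof
    assume "(x, y) \<in> open_segment a b"
    then obtain u where u: "0 < u" "u < 1" "(x, y) = (1 - u) *\<^sub>R a + u *\<^sub>R b" and ab: "a \<noteq> b"
      by (auto simp: in_segment)
    obtain a1 a2 b1 b2 where c: "a = (a1, a2)" "b = (b1, b2)" by (cases a, cases b)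
    have xy: "x = (1 - u) * a1 + u * b1" "y = (1 - u) * a2 + u * b2" using u(3) c by auto
    have eq: "a2 + a1 * r = y + x * r \<and> b2 + b1 * r = y + x * r"
      if r: "\<And>n. ereal (y + x * r - real n * r) \<le> v (f $ n)" for r
    proof -
      have A: "0 \<le> a2 + a1 * r - (y + x * r)" "0 \<le> b2 + b1 * r - (y + x * r)"
        using newton_region_halfplane[of "y + x * r" r v f, OF r] that(1) c \<open>a \<in> _\<close> \<open>b \<in> _\<close> by fastforce+
      have "(1 - u) * (a2 + a1 * r - (y + x * r)) + u * (b2 + b1 * r - (y + x * r)) = 0"
        unfolding xy by (simp add: algebra_simps)
      with A u show ?thesis
        by (metis add_nonneg_eq_0_iff diff_gt_0_iff_gt eq_iff_diff_eq_0 less_le mult_eq_0_iff mult_nonneg_nonneg)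
    qed
    have "(a1 - b1) * s = (a1 - b1) * t" "a2 + a1 * s = b2 + b1 * s"
      using eq[OF s] eq[OF t] by (simp_all add: algebra_simps)
    then have "a = b" using st c by auto
    with ab show False by simp
  qed
  moreover have "(x, y) \<in> newton_region v f" using newton_region_generator n by auto
  ultimately show ?thesis by (simp add: newton_vertices_def extreme_point_of_def)
qed

text \<open>An extreme point is one of the generating points. Unless it is some
  \<open>(x m, y m)\<close>, it lies inside a vertical segment above such a point or on a vertical
  translate of the chord to the next one, and these segments belong to the region.\<close>

lemma newton_vertex_on_polygon:
  fixes f :: "'a::zero fps"
  assumes z: "z \<in> newton_vertices v f" and f0: "v (f $ 0) = \<infinity>"
    and pt: "\<And>m. (x m, y m) \<in> newton_region v f" and x0: "x 0 = 1"
    and x_unbounded: "\<And>B. \<exists>m. x m > B"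
    and below: "\<And>m n. ereal (y m + x m * u m - real n * u m) \<le> v (f $ n)"
    and adj: "\<And>m. y (Suc m) + x (Suc m) * u m = y m + x m * u m"
  shows "z \<in> range (\<lambda>m. (x m, y m))"
proof -
  have "z extreme_point_of newton_region v f" using z by (simp add: newton_vertices_def)
  then have ext: "z \<notin> open_segment a b" if "a \<in> newton_region v f" "b \<in> newton_region v f" for a b
    using that by (simp add: extreme_point_of_def)
  obtain n b where nb: "z = (real n, b)" "v (f $ n) \<le> ereal b"
    using extreme_point_of_convex_hull[OF \<open>z extreme_point_of _\<close>[unfolded newton_region_def]] by auto
  have n1: "n \<ge> 1" using nb(2) f0 by (cases n) auto
  \<comment> \<open>Taking the first \<open>m\<close> beyond \<open>n\<close> makes monotonicity of
    \<open>x\<close> unnecessary; \<open>x 0 = 1 \<le> n\<close> ensures that it has a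
    predecessor.\<close>
  define k where "k = (LEAST m. x m > real n)"
  have k: "x k > real n" unfolding k_def using x_unbounded by (rule LeastI_ex)
  then obtain m where m: "k = Suc m" using x0 n1 by (cases k) auto
  have xm: "x m \<le> real n" using not_less_Least[of m "\<lambda>m. x m > real n"] m k_def by simp
  define \<delta> where "\<delta> = b - (y m + x m * u m - real n * u m)"
  have "ereal (y m + x m * u m - real n * u m) \<le> ereal b" using below[of m n] nb(2) by (rule order_trans)
  then have \<delta>: "\<delta> \<ge> 0" by (simp add: \<delta>_def)
  show ?thesis
  proof (cases "x m = real n")
    case True
    have "b = y m"
    proof (rule ccontr)
      assume "b \<noteq> y m"
      with True \<delta> have "\<delta> > 0" "b = y m + \<delta>" by (auto simp: \<delta>_def)
      have "z \<in> open_segment (x m, y m) (x m, y m + 2 * \<delta>)"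
        using \<open>\<delta> > 0\<close> unfolding in_segment nb(1) by (auto intro!: exI[of _ "1/2"] simp: True \<open>b = _\<close> algebra_simps)
      with ext[OF pt newton_region_up[OF pt], of "2 * \<delta>" m m] \<delta> show False by simp
    qed
    then show ?thesis using nb(1) True by (intro range_eqI[of _ _ m]) simp
  next
    case False
    with xm have lt: "x m < real n" "real n < x (Suc m)" using k m by auto
    define \<theta> where "\<theta> = (real n - x m) / (x (Suc m) - x m)"
    have \<theta>: "0 < \<theta>" "\<theta> < 1" "\<theta> * (x (Suc m) - x m) = real n - x m" using lt by (auto simp: \<theta>_def)
    have yS: "y (Suc m) = y m - (x (Suc m) - x m) * u m" using adj[of m] by (simp add: algebra_simps)
    have "(1 - \<theta>) * x m + \<theta> * x (Suc m) = real n" using \<theta>(3) by (simp add: algebra_simps)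
    moreover have "(1 - \<theta>) * (y m + \<delta>) + \<theta> * (y (Suc m) + \<delta>) = b"
    proof -
      have "(1 - \<theta>) * (y m + \<delta>) + \<theta> * (y (Suc m) + \<delta>) = y m + \<delta> - (\<theta> * (x (Suc m) - x m)) * u m"
        unfolding yS by (simp add: algebra_simps)
      then show ?thesis unfolding \<theta>(3) by (simp add: \<delta>_def algebra_simps)
    qed
    ultimately have "z = (1 - \<theta>) *\<^sub>R (x m, y m + \<delta>) + \<theta> *\<^sub>R (x (Suc m), y (Suc m) + \<delta>)"
      by (simp only: nb(1) scaleR_Pair add_Pair real_scaleR_def)
    moreover have "(x m, y m + \<delta>) \<noteq> (x (Suc m), y (Suc m) + \<delta>)" using lt by auto
    ultimately have "z \<in> open_segment (x m, y m + \<delta>) (x (Suc m), y (Suc m) + \<delta>)"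
      using \<theta>(1,2) unfolding in_segment by blast
    with ext[OF newton_region_up[OF pt \<delta>] newton_region_up[OF pt \<delta>], of m "Suc m"] show ?thesis by simp
  qed
qed

section \<open>Substitution into power series in three variables\<close>

abbreviation const3 :: "'a::comm_ring_1 \<Rightarrow> 'a fps3" where
  "const3 x \<equiv> fps_const (fps_const (fps_const x))"

definition ord_ge :: "nat \<Rightarrow> 'a::comm_ring_1 fps3 \<Rightarrow> bool" where
  "ord_ge n A \<longleftrightarrow> (\<forall>a b c. a + b + c < n \<longrightarrow> A $ a $ b $ c = 0)"

text \<open>Truncation by total degree turns the infinite sums of a substitution into polynomial
  expressions, with one cut-off for all coefficients concerned.\<close>

definition eq_upto :: "nat \<Rightarrow> 'a::comm_ring_1 fps3 \<Rightarrow> 'a fps3 \<Rightarrow> bool" where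
  "eq_upto n A B \<longleftrightarrow> (\<forall>a b c. a + b + c \<le> n \<longrightarrow> A $ a $ b $ c = B $ a $ b $ c)"

lemma fps3_eqI: "(\<And>n. eq_upto n A B) \<Longrightarrow> A = B"
  unfolding eq_upto_def by (intro fps_ext) blast

lemma eq_upto_refl [simp]: "eq_upto n A A"
  by (simp add: eq_upto_def)

lemma eq_upto_trans: "eq_upto n A B \<Longrightarrow> eq_upto n B C \<Longrightarrow> eq_upto n A C"
  by (simp add: eq_upto_def)

lemma eq_upto_sym: "eq_upto n A B \<Longrightarrow> eq_upto n B A"
  by (simp add: eq_upto_def)

lemma mult3_nth:
  "(A * B) $ a $ b $ c =
    (\<Sum>i = 0..a. \<Sum>j = 0..b. \<Sum>k = 0..c. A $ i $ j $ k * B $ (a - i) $ (b - j) $ (c - k))"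
  for A B :: "'a::comm_ring_1 fps3"
  by (simp add: fps_mult_nth fps_sum_nth)

lemma eq_upto_mult:
  assumes "eq_upto n A A'" "eq_upto n B B'"
  shows "eq_upto n (A * B) (A' * B')"
  unfolding eq_upto_def
proof (intro allI impI)
  fix a b c assume n: "a + b + c \<le> n"
  show "(A * B) $ a $ b $ c = (A' * B') $ a $ b $ c"
    unfolding mult3_nth
  proof (intro sum.cong refl)
    fix i j k assume "i \<in> {0..a}" "j \<in> {0..b}" "k \<in> {0..c}"
    then have "i + j + k \<le> n" "a - i + (b - j) + (c - k) \<le> n" using n by auto
    then show "A $ i $ j $ k * B $ (a - i) $ (b - j) $ (c - k) = A' $ i $ j $ k * B' $ (a - i) $ (b - j) $ (c - k)"
      using assms by (simp add: eq_upto_def)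
  qed
qed

lemma eq_upto_sum: "(\<And>i. i \<in> S \<Longrightarrow> eq_upto n (A i) (B i)) \<Longrightarrow> eq_upto n (sum A S) (sum B S)"
  by (simp add: eq_upto_def fps_sum_nth)

lemma ord_ge_mult:
  assumes "ord_ge m A" "ord_ge n B"
  shows "ord_ge (m + n) (A * B)"
  unfolding ord_ge_def
proof (intro allI impI)
  fix a b c assume n: "a + b + c < m + n"
  have "A $ i $ j $ k * B $ (a - i) $ (b - j) $ (c - k) = 0"
    if "i \<in> {0..a}" "j \<in> {0..b}" "k \<in> {0..c}" for i j k
  proof -
    have "i + j + k < m \<or> a - i + (b - j) + (c - k) < n" using that n by auto
    then show ?thesis using assms by (auto simp: ord_ge_def)
  qed
  then show "(A * B) $ a $ b $ c = 0"
    unfolding mult3_nth by (intro sum.neutral ballI)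
qed

lemma ord_ge_power: "ord_ge 1 A \<Longrightarrow> ord_ge i (A ^ i)"
proof (induction i)
  case (Suc i)
  then show ?case using ord_ge_mult[of 1 A i "A ^ i"] by simp
qed (simp add: ord_ge_def)

lemma ord_ge_mono: "ord_ge m A \<Longrightarrow> n \<le> m \<Longrightarrow> ord_ge n A"
  by (simp add: ord_ge_def)

lemma ord_ge_add: "ord_ge n A \<Longrightarrow> ord_ge n B \<Longrightarrow> ord_ge n (A + B)"
  by (simp add: ord_ge_def)

lemma eq_upto_zero_iff: "eq_upto n A 0 \<longleftrightarrow> ord_ge (Suc n) A"
  by (auto simp: eq_upto_def ord_ge_def)

lemma const3_sum: "const3 (sum f S) = (\<Sum>i\<in>S. const3 (f i))"
  by (induction S rule: infinite_finite_induct) (simp_all flip: fps_const_add)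

lemma subst1_nth:
  assumes "ord_ge 1 A" "a + b + c \<le> n"
  shows "subst1 f A $ a $ b $ c = (\<Sum>i\<le>n. f $ i * (A ^ i) $ a $ b $ c)"
proof -
  have "(\<Sum>i\<le>n. f $ i * (A ^ i) $ a $ b $ c) = (\<Sum>i\<le>a + b + c. f $ i * (A ^ i) $ a $ b $ c)"
  proof (rule sum.mono_neutral_right)
    show "\<forall>i\<in>{..n} - {..a + b + c}. f $ i * (A ^ i) $ a $ b $ c = 0"
      using ord_ge_power[OF assms(1)] by (auto simp: ord_ge_def)
  qed (use assms in auto)
  then show ?thesis by (simp add: subst1_def)
qed

lemma subst1_eq_upto:
  assumes "ord_ge 1 A"
  shows "eq_upto n (subst1 f A) (\<Sum>i\<le>n. const3 (f $ i) * A ^ i)"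
  unfolding eq_upto_def using subst1_nth[OF assms] by (simp add: fps_sum_nth)

lemma ord_ge_subst1: "f $ 0 = 0 \<Longrightarrow> ord_ge 1 (subst1 f A)"
  by (simp add: ord_ge_def subst1_def)

lemma subst1_diff: "subst1 (f - g) A = subst1 f A - subst1 g A"
  by (intro fps_ext) (simp add: subst1_def left_diff_distrib sum_subtractf)

lemma subst1_one: "subst1 1 A = 1"
proof (intro fps_ext)
  fix a b c
  have "subst1 1 A $ a $ b $ c = (\<Sum>i\<le>a + b + c. if i = 0 then 1 $ a $ b $ c else 0)"
    unfolding subst1_def fps_nth_Abs_fps by (intro sum.cong) auto
  then show "subst1 1 A $ a $ b $ c = 1 $ a $ b $ c" by simp
qed

text \<open>\<open>A ^ i * B ^ j\<close> has order at least \<open>i + j\<close>, so only the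
  triangle \<open>i + j \<le> n\<close> of the square of index pairs is visible up to degree
  \<open>n\<close>.\<close>

lemma eq_upto_cauchy_product:
  fixes f g :: "nat \<Rightarrow> 'a::comm_ring_1"
  assumes "ord_ge 1 A" "ord_ge 1 B"
  shows "eq_upto n ((\<Sum>i\<le>n. const3 (f i) * A ^ i) * (\<Sum>j\<le>n. const3 (g j) * B ^ j))
    (\<Sum>k\<le>n. \<Sum>i\<le>k. const3 (f i * g (k - i)) * (A ^ i * B ^ (k - i)))"
proof -
  define T where "T = (\<lambda>i j. const3 (f i * g j) * (A ^ i * B ^ j))"
  have T0: "eq_upto n (T i j) 0" if "i + j > n" for i j
  proof -
    have "ord_ge (i + j) (A ^ i * B ^ j)"
      using assms by (intro ord_ge_mult ord_ge_power)
    then have "ord_ge (Suc n) (A ^ i * B ^ j)" by (rule ord_ge_mono) (use that in simp)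
    then show ?thesis unfolding T_def eq_upto_zero_iff by (simp add: ord_ge_def)
  qed
  have "(\<Sum>i\<le>n. const3 (f i) * A ^ i) * (\<Sum>j\<le>n. const3 (g j) * B ^ j) = (\<Sum>i\<le>n. \<Sum>j\<le>n. T i j)"
    by (simp add: sum_product T_def mult_ac flip: fps_const_mult)
  also have "\<dots> = (\<Sum>(i, j)\<in>{..n} \<times> {..n}. T i j)"
    by (simp add: sum.cartesian_product)
  finally have 1: "(\<Sum>i\<le>n. const3 (f i) * A ^ i) * (\<Sum>j\<le>n. const3 (g j) * B ^ j)
      = (\<Sum>(i, j)\<in>{..n} \<times> {..n}. T i j)" .
  have "(\<Sum>k\<le>n. \<Sum>i\<le>k. T i (k - i)) = (\<Sum>(i, j)\<in>{(i, j). i + j \<le> n}. T i j)"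
    by (simp add: sum.triangle_reindex_eq)
  also have "\<dots> = (\<Sum>(i, j)\<in>{..n} \<times> {..n}. if i + j \<le> n then T i j else 0)"
    by (intro sum.mono_neutral_cong_left) (auto split: if_splits)
  finally have 2: "(\<Sum>k\<le>n. \<Sum>i\<le>k. T i (k - i))
      = (\<Sum>(i, j)\<in>{..n} \<times> {..n}. if i + j \<le> n then T i j else 0)" .
  have "eq_upto n (\<Sum>(i, j)\<in>{..n} \<times> {..n}. T i j)
      (\<Sum>(i, j)\<in>{..n} \<times> {..n}. if i + j \<le> n then T i j else 0)"
    using T0 by (intro eq_upto_sum) (auto simp: not_le)
  then show ?thesis unfolding 1 2[symmetric] by (simp add: T_def)
qed

lemma subst1_mult:
  assumes "ord_ge 1 A"
  shows "subst1 (f * g) A = subst1 f A * subst1 g A"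
proof (rule fps3_eqI)
  fix n
  have "(\<Sum>i\<le>n. const3 ((f * g) $ i) * A ^ i)
      = (\<Sum>k\<le>n. \<Sum>i\<le>k. const3 (f $ i * g $ (k - i)) * (A ^ i * A ^ (k - i)))"
  proof (intro sum.cong refl)
    fix k
    have "const3 ((f * g) $ k) * A ^ k = (\<Sum>i\<le>k. const3 (f $ i * g $ (k - i)) * A ^ k)"
      unfolding fps_mult_nth atLeast0AtMost const3_sum sum_distrib_right ..
    also have "\<dots> = (\<Sum>i\<le>k. const3 (f $ i * g $ (k - i)) * (A ^ i * A ^ (k - i)))"
      by (intro sum.cong refl) (simp flip: power_add)
    finally show "const3 ((f * g) $ k) * A ^ k = (\<Sum>i\<le>k. const3 (f $ i * g $ (k - i)) * (A ^ i * A ^ (k - i)))" .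
  qed
  then have "eq_upto n (subst1 (f * g) A)
      (\<Sum>k\<le>n. \<Sum>i\<le>k. const3 (f $ i * g $ (k - i)) * (A ^ i * A ^ (k - i)))"
    using subst1_eq_upto[OF assms, of n "f * g"] by simp
  also have "eq_upto n \<dots> ((\<Sum>i\<le>n. const3 (f $ i) * A ^ i) * (\<Sum>j\<le>n. const3 (g $ j) * A ^ j))"
    by (rule eq_upto_sym[OF eq_upto_cauchy_product[OF assms assms]])
  finally (eq_upto_trans) show "eq_upto n (subst1 (f * g) A) (subst1 f A * subst1 g A)"
    by (rule eq_upto_trans) (intro eq_upto_mult eq_upto_sym[OF subst1_eq_upto[OF assms]])
qed

lemma subst1_power: "ord_ge 1 A \<Longrightarrow> subst1 (f ^ k) A = subst1 f A ^ k"
  by (induction k) (simp_all add: subst1_one subst1_mult)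

lemma subst1_compose:
  assumes A: "ord_ge 1 A" and g: "g $ 0 = 0"
  shows "subst1 (f oo g) A = subst1 f (subst1 g A)"
proof (rule fps3_eqI)
  fix n
  \<comment> \<open>The powers \<open>g ^ k\<close> with \<open>k > i\<close> do not reach index
    \<open>i\<close>; a range of \<open>k\<close> independent of \<open>i\<close> allows the sums to
    be swapped.\<close>
  have nth: "(f oo g) $ i = (\<Sum>k\<le>n. f $ k * (g ^ k) $ i)" if "i \<le> n" for i
  proof -
    have "(\<Sum>k\<le>n. f $ k * (g ^ k) $ i) = (\<Sum>k\<in>{0..i}. f $ k * (g ^ k) $ i)"
      using that g by (intro sum.mono_neutral_right) (auto simp: startsby_zero_power_prefix)
    then show ?thesis by (simp add: fps_compose_nth)
  qed
  have "eq_upto n (subst1 (f oo g) A) (\<Sum>i\<le>n. const3 ((f oo g) $ i) * A ^ i)"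
    by (rule subst1_eq_upto[OF A])
  also have "(\<Sum>i\<le>n. const3 ((f oo g) $ i) * A ^ i)
      = (\<Sum>i\<le>n. \<Sum>k\<le>n. const3 (f $ k) * (const3 ((g ^ k) $ i) * A ^ i))"
  proof (intro sum.cong refl)
    fix i assume "i \<in> {..n}"
    then have "const3 ((f oo g) $ i) * A ^ i = (\<Sum>k\<le>n. const3 (f $ k * (g ^ k) $ i)) * A ^ i"
      by (simp only: nth atMost_iff const3_sum)
    also have "\<dots> = (\<Sum>k\<le>n. const3 (f $ k) * (const3 ((g ^ k) $ i) * A ^ i))"
      by (simp only: sum_distrib_right mult.assoc flip: fps_const_mult)
    finally show "const3 ((f oo g) $ i) * A ^ i = (\<Sum>k\<le>n. const3 (f $ k) * (const3 ((g ^ k) $ i) * A ^ i))" .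
  qed
  also have "\<dots> = (\<Sum>k\<le>n. const3 (f $ k) * (\<Sum>i\<le>n. const3 ((g ^ k) $ i) * A ^ i))"
    by (subst sum.swap) (simp only: sum_distrib_left)
  finally have 1: "eq_upto n (subst1 (f oo g) A)
      (\<Sum>k\<le>n. const3 (f $ k) * (\<Sum>i\<le>n. const3 ((g ^ k) $ i) * A ^ i))" .
  have 2: "eq_upto n (\<Sum>k\<le>n. const3 (f $ k) * (\<Sum>i\<le>n. const3 ((g ^ k) $ i) * A ^ i))
      (\<Sum>k\<le>n. const3 (f $ k) * subst1 g A ^ k)"
    unfolding subst1_power[OF A, symmetric]
    by (intro eq_upto_sum eq_upto_mult eq_upto_refl eq_upto_sym[OF subst1_eq_upto[OF A]])
  have 3: "eq_upto n (\<Sum>k\<le>n. const3 (f $ k) * subst1 g A ^ k) (subst1 f (subst1 g A))"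
    by (rule eq_upto_sym[OF subst1_eq_upto[OF ord_ge_subst1[of g, OF g]]])
  show "eq_upto n (subst1 (f oo g) A) (subst1 f (subst1 g A))"
    by (rule eq_upto_trans[OF 1 eq_upto_trans[OF 2 3]])
qed

lemma subst1_exp_add:
  fixes c :: "'a::field_char_0"
  assumes "ord_ge 1 A" "ord_ge 1 B"
  shows "subst1 (fps_exp c) (A + B) = subst1 (fps_exp c) A * subst1 (fps_exp c) B"
proof (rule fps3_eqI)
  fix n
  have coeff: "fps_exp c $ k * of_nat (k choose i) = fps_exp c $ i * fps_exp c $ (k - i)" if "i \<le> k" for i k
    using that by (simp add: binomial_fact field_simps flip: power_add)
  have "(\<Sum>k\<le>n. const3 (fps_exp c $ k) * (A + B) ^ k)
      = (\<Sum>k\<le>n. \<Sum>i\<le>k. const3 (fps_exp c $ i * fps_exp c $ (k - i)) * (A ^ i * B ^ (k - i)))"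
  proof (intro sum.cong refl)
    fix k
    have "const3 (fps_exp c $ k) * (A + B) ^ k
        = (\<Sum>i\<le>k. const3 (fps_exp c $ k) * (of_nat (k choose i) * A ^ i * B ^ (k - i)))"
      unfolding binomial_ring sum_distrib_left ..
    also have "\<dots> = (\<Sum>i\<le>k. const3 (fps_exp c $ i * fps_exp c $ (k - i)) * (A ^ i * B ^ (k - i)))"
    proof (intro sum.cong refl)
      fix i assume "i \<in> {..k}"
      then show "const3 (fps_exp c $ k) * (of_nat (k choose i) * A ^ i * B ^ (k - i))
          = const3 (fps_exp c $ i * fps_exp c $ (k - i)) * (A ^ i * B ^ (k - i))"
        by (simp add: coeff[symmetric] fps_of_nat[symmetric] mult.assoc[symmetric]
            flip: fps_const_mult del: fps_exp_nth)
    qed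
    finally show "const3 (fps_exp c $ k) * (A + B) ^ k
        = (\<Sum>i\<le>k. const3 (fps_exp c $ i * fps_exp c $ (k - i)) * (A ^ i * B ^ (k - i)))" .
  qed
  then have "eq_upto n (subst1 (fps_exp c) (A + B))
      (\<Sum>k\<le>n. \<Sum>i\<le>k. const3 (fps_exp c $ i * fps_exp c $ (k - i)) * (A ^ i * B ^ (k - i)))"
    using subst1_eq_upto[OF ord_ge_add[OF assms], of n "fps_exp c"] by simp
  also have "eq_upto n \<dots> ((\<Sum>i\<le>n. const3 (fps_exp c $ i) * A ^ i) * (\<Sum>j\<le>n. const3 (fps_exp c $ j) * B ^ j))"
    by (rule eq_upto_sym[OF eq_upto_cauchy_product[OF assms]])
  finally (eq_upto_trans) show "eq_upto n (subst1 (fps_exp c) (A + B)) (subst1 (fps_exp c) A * subst1 (fps_exp c) B)"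
    by (rule eq_upto_trans) (intro eq_upto_mult eq_upto_sym[OF subst1_eq_upto] assms)
qed

section \<open>Substitution of variables and into bilinear laws\<close>

lemma var_monomial_nth: "(var_X ^ i * var_Y ^ j) $ a $ b $ c = (if a = i \<and> b = j \<and> c = 0 then 1 else 0)"
  by (simp add: var_X_def var_Y_def fps_X_power_mult_nth fps_X_power_nth)

lemma var_X_power_nth: "(var_X ^ i) $ a $ b $ c = (if a = i \<and> b = 0 \<and> c = 0 then 1 else 0)"
  using var_monomial_nth[of i 0 a b c] by simp

lemma var_Y_power_nth: "(var_Y ^ i) $ a $ b $ c = (if a = 0 \<and> b = i \<and> c = 0 then 1 else 0)"
  using var_monomial_nth[of 0 i a b c] by simp

lemma subst2_var_nth: "subst2 F var_X var_Y $ a $ b $ c = (if c = 0 then F $ a $ b else 0)"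
proof -
  have "subst2 F var_X var_Y $ a $ b $ c
      = (\<Sum>i\<le>a + b + c. \<Sum>j\<le>a + b + c. if j = b then if i = a then if c = 0 then F $ a $ b else 0 else 0 else 0)"
    unfolding subst2_def fps_nth_Abs_fps by (intro sum.cong refl) (simp add: var_monomial_nth)
  then show ?thesis by (simp add: sum.delta)
qed

lemma subst1_var_X_nth: "subst1 g var_X $ a $ b $ c = (if b = 0 \<and> c = 0 then g $ a else 0)"
proof -
  have "subst1 g var_X $ a $ b $ c = (\<Sum>i\<le>a + b + c. if i = a then if b = 0 \<and> c = 0 then g $ a else 0 else 0)"
    unfolding subst1_def fps_nth_Abs_fps by (intro sum.cong refl) (simp add: var_X_power_nth)
  then show ?thesis by simp
qed

lemma subst1_var_Y_nth: "subst1 g var_Y $ a $ b $ c = (if a = 0 \<and> c = 0 then g $ b else 0)"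
proof -
  have "subst1 g var_Y $ a $ b $ c = (\<Sum>i\<le>a + b + c. if i = b then if a = 0 \<and> c = 0 then g $ b else 0 else 0)"
    unfolding subst1_def fps_nth_Abs_fps by (intro sum.cong refl) (simp add: var_Y_power_nth)
  then show ?thesis by simp
qed

lemma ord_ge_var: "ord_ge 1 var_X" "ord_ge 1 var_Y"
  by (auto simp: ord_ge_def var_X_def var_Y_def)

lemma subst2_bilinear:
  assumes F: "F $ 0 $ 0 = 0" "\<And>i j. 1 < i \<or> 1 < j \<Longrightarrow> F $ i $ j = 0"
    and A: "ord_ge 1 A" and B: "ord_ge 1 B"
  shows "subst2 F A B = const3 (F $ 1 $ 0) * A + const3 (F $ 0 $ 1) * B + const3 (F $ 1 $ 1) * (A * B)"
proof (intro fps_ext)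
  fix a b c
  have "(\<Sum>i\<le>a + b + c. \<Sum>j\<le>a + b + c. F $ i $ j * (A ^ i * B ^ j) $ a $ b $ c)
      = (\<Sum>i\<le>1. \<Sum>j\<le>1. F $ i $ j * (A ^ i * B ^ j) $ a $ b $ c)"
  proof (cases "a + b + c = 0")
    case True
    \<comment> \<open>In total degree 0 the defining sum stops at \<open>i = j = 0\<close>; the
      terms added on the right vanish since \<open>A\<close> and \<open>B\<close> have positive
      order.\<close>
    have "ord_ge 2 (A * B)" using ord_ge_mult[OF A B] by (simp add: numeral_2_eq_2)
    with True F A B show ?thesis by (simp add: ord_ge_def)
  next
    case False
    have inner: "(\<Sum>j\<le>a + b + c. F $ i $ j * (A ^ i * B ^ j) $ a $ b $ c)
        = (\<Sum>j\<le>1. F $ i $ j * (A ^ i * B ^ j) $ a $ b $ c)" for i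
      using False F(2) by (intro sum.mono_neutral_right) auto
    show ?thesis unfolding inner using False F(2) by (intro sum.mono_neutral_right) auto
  qed
  then show "subst2 F A B $ a $ b $ c
      = (const3 (F $ 1 $ 0) * A + const3 (F $ 0 $ 1) * B + const3 (F $ 1 $ 1) * (A * B)) $ a $ b $ c"
    using F(1) by (simp add: subst2_def)
qed

lemma subst2_additive: "ord_ge 1 A \<Longrightarrow> ord_ge 1 B \<Longrightarrow> subst2 additive_group A B = A + B"
  by (subst subst2_bilinear) (auto simp: additive_group_def fps_X_def)

lemma subst2_multiplicative:
  "ord_ge 1 A \<Longrightarrow> ord_ge 1 B \<Longrightarrow> subst2 multiplicative_group A B = A + B + A * B"
  by (subst subst2_bilinear) (auto simp: multiplicative_group_def fps_X_def)

section \<open>Homomorphisms of formal groups\<close>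

lemma ord_ge_law:
  assumes "formal_group_law R F"
  shows "ord_ge 1 (subst2 F var_X var_Y)"
  using assms by (simp add: ord_ge_def subst2_var_nth formal_group_law_def)

text \<open>The exponential turns the additivity of \<open>l\<close> into multiplicativity for every
  \<open>c\<close>, so integrality is the only condition. This makes
  \<open>c = \<Omega> / \<pi>\<close> a candidate to be compared with the generator.\<close>

lemma exp_log_hom:
  fixes l :: "'a::nonarch_normed_field fps"
  assumes F: "formal_group_law R F" and l: "is_formal_log L F l"
    and int: "\<And>n. vabs (((fps_exp c oo l) - 1) $ n) \<le> 1"
  shows "formal_hom o_Cp F multiplicative_group ((fps_exp c oo l) - 1)"
proof -
  define G where "G = subst2 F var_X var_Y"
  define E where "E = fps_exp c oo l"
  have G: "ord_ge 1 G" unfolding G_def using F by (rule ord_ge_law)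
  have l0: "l $ 0 = 0" and hom: "subst1 l G = subst2 additive_group (subst1 l var_X) (subst1 l var_Y)"
    using l by (auto simp: is_formal_log_def formal_hom_def G_def)
  note ord = ord_ge_subst1[of l, OF l0]
  have "subst1 E G = subst1 (fps_exp c) (subst1 l var_X + subst1 l var_Y)"
    unfolding E_def subst1_compose[OF G l0] hom subst2_additive[OF ord ord] ..
  also have "\<dots> = subst1 E var_X * subst1 E var_Y"
    unfolding E_def subst1_compose[OF ord_ge_var(1) l0] subst1_compose[OF ord_ge_var(2) l0]
    by (rule subst1_exp_add[OF ord ord])
  finally have "subst1 (E - 1) G = subst1 E var_X * subst1 E var_Y - 1"
    by (simp add: subst1_diff subst1_one)
  also have "\<dots> = subst1 (E - 1) var_X + subst1 (E - 1) var_Y + subst1 (E - 1) var_X * subst1 (E - 1) var_Y"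
    by (simp add: subst1_diff subst1_one algebra_simps)
  also have "\<dots> = subst2 multiplicative_group (subst1 (E - 1) var_X) (subst1 (E - 1) var_Y)"
    by (intro subst2_multiplicative[symmetric] ord_ge_subst1) (simp_all add: E_def)
  finally have H: "subst1 (E - 1) G = subst2 multiplicative_group (subst1 (E - 1) var_X) (subst1 (E - 1) var_Y)" .
  show ?thesis
    unfolding formal_hom_def
  proof (intro conjI allI)
    show "((fps_exp c oo l) - 1) $ n \<in> o_Cp" for n using int[of n] unfolding o_Cp_def by blast
    show "subst1 ((fps_exp c oo l) - 1) (subst2 F var_X var_Y) =
        subst2 multiplicative_group (subst1 ((fps_exp c oo l) - 1) var_X) (subst1 ((fps_exp c oo l) - 1) var_Y)"
      using H unfolding E_def G_def .
  qed simp
qed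

lemma power_nth_1: "(A ^ Suc i) $ 1 = of_nat (Suc i) * (A $ 0) ^ i * A $ 1"
  for A :: "'a::comm_ring_1 fps"
proof (induction i)
  case (Suc i)
  have "(A ^ Suc (Suc i)) $ 1 = A $ 0 * (A ^ Suc i) $ 1 + A $ 1 * (A ^ Suc i) $ 0"
    by (subst power_Suc) (simp add: fps_mult_nth)
  with Suc show ?case by (simp add: algebra_simps fps_power_zeroth)
qed simp

text \<open>\<open>F $ 1\<close> is the derivative of \<open>F(X, Y)\<close> with respect to \<open>X\<close> at \<open>X = 0\<close>; its inverse is the
  invariant differential.\<close>

lemma subst1_law_nth_1:
  assumes F: "formal_group_law R F"
  shows "subst1 f (subst2 F var_X var_Y) $ 1 $ b $ 0 = (fps_deriv f * F $ 1) $ b"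
proof -
  define G where "G = subst2 F var_X var_Y"
  have G0: "G $ 0 = fps_X"
    using F by (intro fps_ext) (auto simp: G_def subst2_var_nth formal_group_law_def fps_X_def)
  have pow: "(G ^ Suc k) $ 1 $ b $ 0 = of_nat (Suc k) * (if b < k then 0 else F $ 1 $ (b - k))" for k
  proof -
    have "of_nat (Suc k) = (fps_const (fps_const (of_nat (Suc k))) :: 'a fps fps)"
      by (simp add: fps_of_nat del: of_nat_Suc)
    then have "(G ^ Suc k) $ 1 = fps_const (fps_const (of_nat (Suc k))) * (fps_X ^ k * G $ 1)"
      unfolding power_nth_1 G0 by (simp only: mult.assoc)
    then have "(G ^ Suc k) $ 1 $ b $ 0 = of_nat (Suc k) * (fps_X ^ k * G $ 1) $ b $ 0"
      by (simp del: of_nat_Suc power_Suc)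
    then show ?thesis by (simp add: fps_X_power_mult_nth G_def subst2_var_nth del: of_nat_Suc power_Suc)
  qed
  have "subst1 f G $ 1 $ b $ 0 = (\<Sum>i\<le>Suc b. f $ i * (G ^ i) $ 1 $ b $ 0)"
    unfolding subst1_def by simp
  also have "\<dots> = (\<Sum>k\<le>b. f $ Suc k * (G ^ Suc k) $ 1 $ b $ 0)"
    by (subst sum.atMost_Suc_shift) simp
  also have "\<dots> = (\<Sum>k = 0..b. fps_deriv f $ k * F $ 1 $ (b - k))"
    unfolding pow by (intro sum.cong) (auto simp: mult_ac)
  also have "\<dots> = (fps_deriv f * F $ 1) $ b" by (simp add: fps_mult_nth)
  finally show ?thesis by (simp add: G_def)
qed

text \<open>Differentiate \<open>l(F(X, Y)) = l(X) + l(Y)\<close> with respect to \<open>X\<close>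
  at \<open>X = 0\<close>.\<close>

lemma log_deriv:
  assumes F: "formal_group_law R F" and l: "is_formal_log L F l"
  shows "fps_deriv l * F $ 1 = 1"
proof (rule fps_ext)
  fix b
  have l0: "l $ 0 = 0" "l $ 1 = 1"
    and hom: "subst1 l (subst2 F var_X var_Y) = subst2 additive_group (subst1 l var_X) (subst1 l var_Y)"
    using l by (auto simp: is_formal_log_def formal_hom_def)
  have "(fps_deriv l * F $ 1) $ b = (subst1 l var_X + subst1 l var_Y) $ 1 $ b $ 0"
    unfolding subst1_law_nth_1[OF F, symmetric] hom
    by (simp only: subst2_additive[OF ord_ge_subst1[of l, OF l0(1)] ord_ge_subst1[of l, OF l0(1)]])
  then show "(fps_deriv l * F $ 1) $ b = 1 $ b"
    using l0(2) by (simp add: subst1_var_X_nth subst1_var_Y_nth)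
qed

text \<open>Differentiate \<open>g(F(X, Y)) = F(g(X), g(Y))\<close> with respect to \<open>X\<close>
  at \<open>X = 0\<close>: on the right only the terms linear in \<open>g(X)\<close>
  survive.\<close>

lemma endomorphism_deriv:
  assumes F: "formal_group_law R F" and g: "formal_hom R F F g"
  shows "fps_deriv g * F $ 1 = fps_const (g $ 1) * (F $ 1 oo g)"
proof (rule fps_ext)
  fix b
  have g0: "g $ 0 = 0"
    and hom: "subst1 g (subst2 F var_X var_Y) = subst2 F (subst1 g var_X) (subst1 g var_Y)"
    using g by (auto simp: formal_hom_def)
  have prod: "(subst1 g var_X ^ i * subst1 g var_Y ^ j) $ 1 $ b $ 0 = (if i = 1 then g $ 1 * (g ^ j) $ b else 0)" for i j
  proof -
    have "(subst1 g var_X ^ i * subst1 g var_Y ^ j) $ 1 $ b $ 0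
        = (\<Sum>k = 0..b. if k = 0 then (g ^ i) $ 1 * (g ^ j) $ b else 0)"
      unfolding subst1_power[OF ord_ge_var(1), symmetric] subst1_power[OF ord_ge_var(2), symmetric] mult3_nth
      by (simp add: subst1_var_X_nth subst1_var_Y_nth mult_delta_left)
    also have "\<dots> = (g ^ i) $ 1 * (g ^ j) $ b" by simp
    also have "(g ^ i) $ 1 = (if i = 1 then g $ 1 else 0)"
    proof (cases i)
      case (Suc k)
      then show ?thesis using power_nth_1[of g k] g0 by (cases k) auto
    qed simp
    finally show ?thesis by simp
  qed
  have "(fps_deriv g * F $ 1) $ b = (\<Sum>i\<le>Suc b. \<Sum>j\<le>Suc b. F $ i $ j * (if i = 1 then g $ 1 * (g ^ j) $ b else 0))"
    unfolding subst1_law_nth_1[OF F, symmetric] hom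
    by (simp only: subst2_def fps_nth_Abs_fps prod add_0_right plus_1_eq_Suc)
  also have "\<dots> = (\<Sum>i\<le>Suc b. if i = 1 then \<Sum>j\<le>Suc b. F $ 1 $ j * (g $ 1 * (g ^ j) $ b) else 0)"
    by (intro sum.cong) auto
  also have "\<dots> = (\<Sum>j\<le>Suc b. F $ 1 $ j * (g $ 1 * (g ^ j) $ b))"
    by simp
  also have "\<dots> = (\<Sum>j = 0..b. F $ 1 $ j * (g $ 1 * (g ^ j) $ b))"
    using startsby_zero_power_prefix[OF g0, of "Suc b"] by (simp add: atLeast0AtMost)
  also have "\<dots> = (fps_const (g $ 1) * (F $ 1 oo g)) $ b"
    by (simp add: fps_compose_nth sum_distrib_left mult_ac)
  finally show "(fps_deriv g * F $ 1) $ b = (fps_const (g $ 1) * (F $ 1 oo g)) $ b" .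
qed

text \<open>An endomorphism multiplies the invariant differential by its linear coefficient. In
  characteristic 0 this integrates, as neither side has a constant term.\<close>

lemma log_endomorphism:
  fixes F :: "'a::nonarch_normed_field fps fps"
  assumes F: "formal_group_law R F" and l: "is_formal_log L F l" and g: "formal_hom R F F g"
  shows "l oo g = fps_const (g $ 1) * l"
proof -
  have g0: "g $ 0 = 0" and l0: "l $ 0 = 0"
    using g l by (auto simp: formal_hom_def is_formal_log_def)
  have "F $ 1 $ 0 = 1" using F by (simp add: formal_group_law_def)
  then have nz: "F $ 1 \<noteq> 0" by auto
  have "fps_deriv (l oo g) * F $ 1 = (fps_deriv l oo g) * (fps_deriv g * F $ 1)"
    by (simp add: fps_compose_deriv[OF g0] mult.assoc)
  also have "\<dots> = fps_const (g $ 1) * ((fps_deriv l * F $ 1) oo g)"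
    unfolding endomorphism_deriv[OF F g] fps_compose_mult_distrib[OF g0] by (simp add: mult_ac)
  also have "\<dots> = fps_deriv (fps_const (g $ 1) * l) * F $ 1"
    unfolding log_deriv[OF F l] by (simp add: log_deriv[OF F l, simplified] mult.assoc)
  finally have "fps_deriv (l oo g) = fps_deriv (fps_const (g $ 1) * l)"
    using nz by simp
  then have "l oo g = fps_const ((l oo g) $ 0 - (fps_const (g $ 1) * l) $ 0) + fps_const (g $ 1) * l"
    by (rule iffD1[OF fps_deriv_eq_iff])
  then show ?thesis by (simp add: l0)
qed

section \<open>Coefficients as polynomials in the period\<close>

lemma const_poly_fps_power_nth:
  "(Abs_fps (\<lambda>i. [:l $ i:]) ^ k) $ n = [:(l ^ k) $ n:]" for l :: "'a::comm_ring_1 fps"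
proof (induction k arbitrary: n)
  case (Suc k)
  have sum: "(\<Sum>i\<in>S. [:f i:]) = [:sum f S:]" for S :: "nat set" and f :: "nat \<Rightarrow> 'a"
    by (induction S rule: infinite_finite_induct) simp_all
  show ?case by (simp add: fps_mult_nth Suc sum mult.commute)
qed (simp add: fps_one_nth)

lemma Delta1_eq_P_poly:
  "Delta1 \<Omega> l - 1 = Abs_fps (\<lambda>n. if n \<ge> 1 then poly (P_poly l n) \<Omega> else 0)"
proof (rule fps_ext)
  fix n
  have "poly (P_poly l n) \<Omega> = (Delta1 \<Omega> l) $ n"
    by (simp add: P_poly_def Delta1_def fps_compose_nth const_poly_fps_power_nth poly_sum poly_monom
        mult_ac)
  then show "(Delta1 \<Omega> l - 1) $ n = Abs_fps (\<lambda>n. if n \<ge> 1 then poly (P_poly l n) \<Omega> else 0) $ n"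
    by (cases n) (auto simp: Delta1_def)
qed

section \<open>The period of a Lubin--Tate group\<close>

locale lubin_tate_period =
  fixes L :: "'a::{nonarch_normed_field, alg_closed_field, complete_space} set"
    and p d e q :: nat and \<pi> \<Omega> :: 'a
    and F :: "'a fps fps" and br :: "'a \<Rightarrow> 'a fps" and l :: "'a fps"
  assumes is_Cp: "is_Cp p TYPE('a)"
    and finite_ext: "finite_ext_Qp L d"
    and uniformizer: "is_uniformizer L \<pi>"
    and ramification: "is_ramification_index p L \<pi> e"
    and q_def: "q = residue_card L"
    and group: "lubin_tate_group L \<pi> F br"
    and log: "is_formal_log L F l"
    and period: "is_period L F br l \<Omega>"
begin

abbreviation c :: real where "c \<equiv> vabs \<pi>"

section \<open>Arithmetic of the ring of integers\<close>

lemma prime_p: "prime p" and vabs_p: "vabs (of_nat p :: 'a) = 1 / real p"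
  using is_Cp by (auto simp: is_Cp_def)

lemma p_ge_2: "p \<ge> 2"
  using prime_p by (rule prime_ge_2_nat)

lemma subfield: "is_subfield L"
  using finite_ext by (simp add: finite_ext_Qp_def)

lemma rat_in_L: "x \<in> \<rat> \<Longrightarrow> x \<in> L"
  using finite_ext closure_subset[of "\<rat> :: 'a set"] by (auto simp: finite_ext_Qp_def Qp_def)

lemma L_mult: "x \<in> L \<Longrightarrow> y \<in> L \<Longrightarrow> x * y \<in> L"
  and L_diff: "x \<in> L \<Longrightarrow> y \<in> L \<Longrightarrow> x - y \<in> L"
  using subfield by (auto simp: is_subfield_def)

lemma o_ring_mult: "x \<in> o_ring L \<Longrightarrow> y \<in> o_ring L \<Longrightarrow> x * y \<in> o_ring L"
  by (auto simp: o_ring_def vabs_mult L_mult mult_le_one)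

lemma o_ring_of_nat: "of_nat n \<in> o_ring L"
  by (simp add: o_ring_def vabs_of_nat_le rat_in_L)

lemma o_ring_1: "1 \<in> o_ring L"
  using o_ring_of_nat[of 1] by simp

lemma pi_in: "\<pi> \<in> o_ring L" and pi_ideal: "(*) \<pi> ` o_ring L = max_ideal L"
  using uniformizer by (auto simp: is_uniformizer_def)

lemma o_ring_pi_power: "\<pi> ^ k \<in> o_ring L"
  by (induction k) (simp_all add: o_ring_1 o_ring_mult pi_in)

lemma c_less_1: "c < 1"
proof -
  have "\<pi> * 1 \<in> max_ideal L" unfolding pi_ideal[symmetric] using o_ring_1 by blast
  then show ?thesis by (simp add: max_ideal_def)
qed

lemma pi_nonzero: "\<pi> \<noteq> 0"
proof
  assume "\<pi> = 0"
  have "(of_nat p :: 'a) \<in> max_ideal L"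
    using p_ge_2 o_ring_of_nat[of p] by (simp add: max_ideal_def o_ring_def vabs_p)
  then have "(of_nat p :: 'a) = 0" using \<open>\<pi> = 0\<close> by (auto simp flip: pi_ideal)
  then show False using p_ge_2 by simp
qed

lemma c_pos: "c > 0"
  using pi_nonzero by simp

lemma p_eq_unit: obtains \<upsilon> where "\<upsilon> \<in> o_ring L" "of_nat p = \<pi> ^ e * \<upsilon>" "vabs \<upsilon> = 1"
proof -
  have eq: "(*) (of_nat p) ` o_ring L = (*) (\<pi> ^ e) ` o_ring L"
    using ramification by (simp add: is_ramification_index_def)
  have "of_nat p * 1 \<in> (*) (\<pi> ^ e) ` o_ring L" unfolding eq[symmetric] using o_ring_1 by (rule imageI)
  then obtain x where x: "x \<in> o_ring L" "of_nat p = \<pi> ^ e * x" by auto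
  have "\<pi> ^ e * 1 \<in> (*) (of_nat p) ` o_ring L" unfolding eq using o_ring_1 by (rule imageI)
  then obtain y where y: "y \<in> o_ring L" "\<pi> ^ e = of_nat p * y" by auto
  have "\<pi> ^ e * (x * y) = \<pi> ^ e * 1" using x(2) y(2) by (simp add: mult_ac)
  then have "x * y = 1" using pi_nonzero by simp
  then have "vabs x * vabs y = 1" by (simp flip: vabs_mult)
  moreover have "vabs x * vabs y \<le> vabs x * 1"
    using y(1) by (intro mult_left_mono) (auto simp: o_ring_def)
  ultimately have "vabs x = 1" using x(1) by (simp add: o_ring_def)
  with x that show ?thesis by blast
qed

lemma c_power_e: "c ^ e = 1 / real p"
proof -
  obtain \<upsilon> where "of_nat p = \<pi> ^ e * \<upsilon>" "vabs \<upsilon> = 1" by (rule p_eq_unit)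
  then show ?thesis by (metis mult.right_neutral vabs_mult vabs_p vabs_power)
qed

lemma e_ge_1: "e \<ge> 1"
  using c_power_e p_ge_2 by (cases e) auto

lemma law: "formal_group_law (o_ring L) F"
  using group by (simp add: lubin_tate_group_def)

lemma br_hom: "a \<in> o_ring L \<Longrightarrow> formal_hom (o_ring L) F F (br a)"
  and br_nth_1: "a \<in> o_ring L \<Longrightarrow> br a $ 1 = a"
  and br_1: "br 1 = fps_X"
  and br_mult: "a \<in> o_ring L \<Longrightarrow> b \<in> o_ring L \<Longrightarrow> br (a * b) = br a oo br b"
  using group by (auto simp: lubin_tate_group_def)

lemma br_nth_0: "a \<in> o_ring L \<Longrightarrow> br a $ 0 = 0"
  and vabs_br: "a \<in> o_ring L \<Longrightarrow> vabs (br a $ n) \<le> 1"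
  using br_hom[of a] by (auto simp: formal_hom_def o_ring_def)

lemma vabs_br_pi: "vabs ((br \<pi> - fps_X ^ q) $ n) \<le> c"
proof -
  have "(br \<pi> - fps_X ^ q) $ n \<in> (*) \<pi> ` o_ring L"
    using group by (simp add: lubin_tate_group_def q_def)
  then obtain y where "y \<in> o_ring L" "(br \<pi> - fps_X ^ q) $ n = \<pi> * y" by auto
  then show ?thesis using c_pos by (simp add: o_ring_def vabs_mult mult_left_le)
qed

text \<open>That the residue field is finite, with at least two elements, is implied by the congruence
  \<open>[\<pi>](Z) \<equiv> Z^q\<close>: \<open>card\<close> of an infinite set is 0.\<close>

lemma q_ge_2: "q \<ge> 2"
proof (rule ccontr)
  assume "\<not> q \<ge> 2"
  then consider "q = 0" | "q = 1" by linarith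
  then show False
  proof cases
    case 1
    then show False using vabs_br_pi[of 0] br_nth_0[OF pi_in] c_less_1 by simp
  next
    case 2
    have "vabs (\<pi> - 1) = 1" using vabs_add_eq[of \<pi> "-1"] c_less_1 by simp
    then show False using 2 vabs_br_pi[of 1] br_nth_1[OF pi_in] c_less_1 by simp
  qed
qed

section \<open>Gauss norms under composition with endomorphisms\<close>

lemma gauss_at_br_pi:
  assumes "0 < r" "r < 1"
  obtains N where "gauss_at (br \<pi>) r N (max (r ^ q) (c * r))"
proof (rule gauss_at_frobenius_like[of "br \<pi>" c q r])
  show "br \<pi> $ 0 = 0" using br_nth_0[OF pi_in] .
  show "vabs (br \<pi> $ 1) = c" using br_nth_1[OF pi_in] by simp
  have "vabs (1 + (br \<pi> - fps_X ^ q) $ q) = vabs (1::'a)"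
    using vabs_br_pi[of q] c_less_1 by (intro vabs_add_eq) simp
  then show "vabs (br \<pi> $ q) = 1" by (simp add: fps_X_power_nth)
  show "vabs (br \<pi> $ n) \<le> c" if "n \<noteq> q" for n
    using vabs_br_pi[of n] that by (simp add: fps_X_power_nth)
qed (use assms q_ge_2 c_pos that in auto)

lemma powr_max: "max (c powr a) (c powr b) = c powr min a b"
  using powr_mono'[of a b c] powr_mono'[of b a c] c_pos c_less_1 by (auto simp: max_def min_def intro: antisym)

text \<open>At radius \<open>c powr u\<close> the Gauss norm of [\<pi>] is
  \<open>c powr vstep q u\<close>, which becomes the radius for the series composed with it.\<close>

lemma gauss_at_compose_br_pi:
  assumes f: "gauss_at f (c powr ((vstep q ^^ k) u)) N \<mu>" and u: "0 < u" and \<mu>: "0 < \<mu>"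
  shows "\<exists>N. gauss_at (f oo br (\<pi> ^ k)) (c powr u) N \<mu>"
  using f u
proof (induction k arbitrary: u N)
  case 0
  then show ?case by (auto simp: br_1)
next
  case (Suc k)
  have r: "0 < c powr u" "c powr u < 1"
    using c_pos c_less_1 Suc.prems(2) powr_less_mono'[of c 0 u] by auto
  have v: "0 < vstep q u" using vstep_pos[of q u] q_ge_2 Suc.prems(2) by simp
  have "max ((c powr u) ^ q) (c * c powr u) = c powr vstep q u"
    using c_pos powr_max[of "real q * u" "u + 1"] by (simp add: powr_power powr_add vstep_def mult.commute)
  then obtain N1 where br: "gauss_at (br \<pi>) (c powr u) N1 (c powr vstep q u)"
    using gauss_at_br_pi[OF r] by metis
  obtain N2 where "gauss_at (f oo br (\<pi> ^ k)) (c powr vstep q u) N2 \<mu>"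
    using Suc.IH[of "vstep q u" N] Suc.prems(1) v by (auto simp: funpow_swap1)
  from gauss_at_compose[OF this br r(1) _ \<mu> br_nth_0[OF pi_in]] c_pos
  have "gauss_at ((f oo br (\<pi> ^ k)) oo br \<pi>) (c powr u) (N2 * N1) \<mu>" by simp
  also have "(f oo br (\<pi> ^ k)) oo br \<pi> = f oo (br (\<pi> ^ k) oo br \<pi>)"
    by (intro fps_compose_assoc[symmetric] br_nth_0 pi_in o_ring_pi_power)
  also have "br (\<pi> ^ k) oo br \<pi> = br (\<pi> ^ Suc k)"
    by (simp add: br_mult o_ring_pi_power pi_in mult.commute flip: br_mult)
  finally show ?case by blast
qed

text \<open>\<open>p\<close> is \<open>\<pi> ^ e\<close> times a unit, and the endomorphism of a
  unit preserves every radius below 1.\<close>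

lemma gauss_at_compose_br_p:
  assumes f: "gauss_at f (c powr ((vstep q ^^ e) u)) N \<mu>" and u: "0 < u" and \<mu>: "0 < \<mu>"
  shows "\<exists>N. gauss_at (f oo br (of_nat p)) (c powr u) N \<mu>"
proof -
  obtain \<upsilon> where \<upsilon>: "\<upsilon> \<in> o_ring L" "of_nat p = \<pi> ^ e * \<upsilon>" "vabs \<upsilon> = 1" by (rule p_eq_unit)
  have r: "0 < c powr u" "c powr u < 1"
    using c_pos c_less_1 u powr_less_mono'[of c 0 u] by auto
  obtain N1 where N1: "gauss_at (f oo br (\<pi> ^ e)) (c powr u) N1 \<mu>"
    using gauss_at_compose_br_pi[OF f u \<mu>] by blast
  have "vabs (br \<upsilon> $ n) * (c powr u) ^ n \<le> c powr u" for n
  proof (cases n)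
    case (Suc m)
    have "vabs (br \<upsilon> $ n) * (c powr u) ^ n \<le> 1 * (c powr u) ^ 1"
      using vabs_br[OF \<upsilon>(1), of n] r Suc by (intro mult_mono power_decreasing) auto
    then show ?thesis by simp
  qed (use r br_nth_0[OF \<upsilon>(1)] in simp)
  then have "gauss_at (br \<upsilon>) (c powr u) 1 (c powr u)"
    using r br_nth_0[OF \<upsilon>(1)] br_nth_1[OF \<upsilon>(1)] \<upsilon>(3) by (simp add: gauss_at_def gauss_le_def)
  from gauss_at_compose[OF N1 this r(1) r(1) \<mu> br_nth_0[OF \<upsilon>(1)]]
  have "gauss_at ((f oo br (\<pi> ^ e)) oo br \<upsilon>) (c powr u) (N1 * 1) \<mu>" .
  also have "(f oo br (\<pi> ^ e)) oo br \<upsilon> = f oo (br (\<pi> ^ e) oo br \<upsilon>)"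
    by (intro fps_compose_assoc[symmetric] br_nth_0 \<upsilon> o_ring_pi_power)
  also have "br (\<pi> ^ e) oo br \<upsilon> = br (of_nat p)"
    by (simp add: \<upsilon>(2) br_mult o_ring_pi_power \<upsilon>(1))
  finally show ?thesis by blast
qed

section \<open>The logarithm and the generator \<open>t\<close>\<close>

lemma log_nth: "l $ 0 = 0" "l $ 1 = 1"
  using log by (auto simp: is_formal_log_def formal_hom_def)

lemma log_br: "a \<in> o_ring L \<Longrightarrow> l oo br a = fps_const a * l"
  using log_endomorphism[OF law log br_hom] br_nth_1 by simp

lemma exp_log_br:
  assumes "a \<in> o_ring L"
  shows "(fps_exp w oo l) oo br a = fps_exp (a * w) oo l"
proof -
  have "(fps_exp w oo l) oo br a = fps_exp w oo (fps_const a * l)"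
    using fps_compose_assoc[of "br a" l "fps_exp w"] log_nth br_nth_0 log_br assms by simp
  also have "fps_const a * l = (fps_const a * fps_X) oo l"
    using log_nth by (simp add: fps_compose_mult_distrib)
  also have "fps_exp w oo ((fps_const a * fps_X) oo l) = (fps_exp w oo (fps_const a * fps_X)) oo l"
    using log_nth by (intro fps_compose_assoc) auto
  finally show ?thesis by simp
qed

abbreviation t :: "'a fps" where "t \<equiv> Delta1 \<Omega> l - 1"

lemma vabs_t: "vabs (t $ n) \<le> 1"
  and t_nth_0: "t $ 0 = 0"
  and t_hom: "formal_hom o_Cp F multiplicative_group t"
  using period by (simp_all add: is_period_def formal_hom_def o_Cp_def)

lemma t_nth_1: "t $ 1 = \<Omega>"
  using log_nth by (simp add: Delta1_def fps_compose_nth)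

lemma t_br_unique: "a \<in> o_ring L \<Longrightarrow> b \<in> o_ring L \<Longrightarrow> t = t oo br a \<Longrightarrow> t = t oo br b \<Longrightarrow> a = b"
  using period t_hom unfolding is_period_def by blast

lemma period_nonzero: "\<Omega> \<noteq> 0"
proof
  assume "\<Omega> = 0"
  then have "t = 0" by (simp add: Delta1_def)
  then have "(0::'a) = 1"
    using t_br_unique[of 0 1] o_ring_of_nat[of 0] o_ring_1 by simp
  then show False by simp
qed

lemma t_nonzero: "t \<noteq> 0"
  using t_nth_1 period_nonzero by (metis fps_zero_nth)

text \<open>Both sides come from \<open>t \<circ> [p] = (1 + t)^p - 1\<close>.\<close>

lemma gauss_functional_eq:
  assumes u: "0 < u" and at: "gauss_at t (c powr u) N \<mu>"
    and at': "gauss_at t (c powr ((vstep q ^^ e) u)) N' \<mu>'" and pos: "0 < \<mu>" "0 < \<mu>'"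
  shows "\<mu>' = max (\<mu> ^ p) (1 / real p * \<mu>)"
proof -
  define \<phi> :: "'a fps" where "\<phi> = (1 + fps_X) ^ p - 1"
  have r: "0 < c powr u" "c powr u < 1"
    using c_pos c_less_1 u powr_less_mono'[of c 0 u] by auto
  have \<phi>_nth: "\<phi> $ n = (if n = 0 then 0 else of_nat (p choose n))" for n
  proof -
    have "((1 + fps_X) ^ p :: 'a fps) $ n = of_nat (p choose n)"
      by (simp add: binomial_gbinomial flip: fps_binomial_of_nat)
    then show ?thesis by (simp add: \<phi>_def)
  qed
  \<comment> \<open>The Gauss norm of \<open>t\<close> becomes the radius for \<phi>, which has to
    be less than 1.\<close>
  have "\<mu> < 1"
  proof (cases "N = 0")
    case True
    then show ?thesis using at pos t_nth_0 by (simp add: gauss_at_def)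
  next
    case False
    have "\<mu> = vabs (t $ N) * (c powr u) ^ N" using at by (simp add: gauss_at_def)
    also have "\<dots> \<le> 1 * (c powr u) ^ 1"
      using r False vabs_t[of N] by (intro mult_mono power_decreasing) auto
    finally show ?thesis using r by simp
  qed
  obtain N1 where "gauss_at \<phi> \<mu> N1 (max (\<mu> ^ p) (1 / real p * \<mu>))"
  proof (rule gauss_at_frobenius_like[of \<phi> "1 / real p" p \<mu>])
    show "vabs (\<phi> $ n) \<le> 1 / real p" if "n \<noteq> p" for n
    proof (cases "n = 0 \<or> p < n")
      case False
      then have "p dvd (p choose n)" using that prime_p by (intro dvd_choose_prime) auto
      then obtain k where "p choose n = p * k" by (elim dvdE)
      then have "vabs (of_nat (p choose n) :: 'a) = 1 / real p * vabs (of_nat k :: 'a)"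
        by (simp add: vabs_mult vabs_p)
      also have "\<dots> \<le> 1 / real p * 1" by (intro mult_left_mono vabs_of_nat_le) auto
      finally show ?thesis by (simp add: \<phi>_nth)
    qed (auto simp: \<phi>_nth binomial_eq_0)
  qed (use p_ge_2 pos \<open>\<mu> < 1\<close> vabs_p in \<open>auto simp: \<phi>_nth\<close>)
  moreover have "max (\<mu> ^ p) (1 / real p * \<mu>) > 0" using pos by (simp add: less_max_iff_disj)
  ultimately have "gauss_at (\<phi> oo t) (c powr u) (N1 * N) (max (\<mu> ^ p) (1 / real p * \<mu>))"
    using gauss_at_compose[OF _ at r(1) pos(1) _ t_nth_0] by blast
  also have "\<phi> oo t = t oo br (of_nat p)"
  proof -
    have E: "1 + t = fps_exp \<Omega> oo l" by (simp add: Delta1_def)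
    have "\<phi> oo t = (1 + t) ^ p - 1"
      unfolding \<phi>_def fps_compose_sub_distrib fps_compose_power[OF t_nth_0, symmetric] fps_compose_add_distrib
      using t_nth_0 by simp
    also have "(1 + t) ^ p = fps_exp (of_nat p * \<Omega>) oo l"
      unfolding E fps_compose_power[OF log_nth(1)] fps_exp_power_mult ..
    also have "\<dots> = (fps_exp \<Omega> oo l) oo br (of_nat p)"
      using exp_log_br[OF o_ring_of_nat] by simp
    finally show ?thesis by (simp add: Delta1_def fps_compose_sub_distrib)
  qed
  finally have 1: "gauss_at (t oo br (of_nat p)) (c powr u) (N1 * N) (max (\<mu> ^ p) (1 / real p * \<mu>))" .
  obtain N2 where "gauss_at (t oo br (of_nat p)) (c powr u) N2 \<mu>'"
    using gauss_at_compose_br_p[OF at' u pos(2)] by blast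
  then show ?thesis using 1 by (rule gauss_at_unique)
qed

section \<open>The valuation polygon of \<open>t\<close>\<close>

definition M :: "real \<Rightarrow> real" where
  "M u = log c (SOME \<mu>. \<exists>N. gauss_at t (c powr u) N \<mu> \<and> 0 < \<mu>)"

lemma gauss_at_M: "0 < u \<Longrightarrow> \<exists>N. gauss_at t (c powr u) N (c powr M u)"
proof -
  assume u: "0 < u"
  have "0 < c powr u" "c powr u < 1"
    using c_pos c_less_1 u powr_less_mono'[of c 0 u] by auto
  then have "\<exists>\<mu> N. gauss_at t (c powr u) N \<mu> \<and> 0 < \<mu>"
    using gauss_at_exists[OF vabs_t t_nonzero] by metis
  then have "\<exists>N. gauss_at t (c powr u) N (SOME \<mu>. \<exists>N. gauss_at t (c powr u) N \<mu> \<and> 0 < \<mu>)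
      \<and> 0 < (SOME \<mu>. \<exists>N. gauss_at t (c powr u) N \<mu> \<and> 0 < \<mu>)"
    by (rule someI_ex)
  then show ?thesis using c_pos c_less_1 by (auto simp: M_def)
qed

lemma powr_c_le_iff: "c powr a \<le> c powr b \<longleftrightarrow> b \<le> a"
  using powr_mono'[of b a c] powr_less_mono'[of c a b] c_pos c_less_1 by (cases "b \<le> a") auto

lemma powr_c_eq_iff: "c powr a = c powr b \<longleftrightarrow> a = b"
  using c_pos c_less_1 by (intro powr_inj) auto

lemma vabs_eq_powr: "x \<noteq> 0 \<Longrightarrow> vabs x = c powr (log c (vabs x))"
  using c_pos c_less_1 by simp

lemma powr_u_power: "(c powr u) ^ n = c powr (real n * u)"
  using c_pos by (simp add: powr_power)

text \<open>Together with \<open>M_attained\<close>, \<open>M u\<close> is the minimum over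
  \<open>n\<close> of \<open>v(t $ n) + n * u\<close>. The base \<open>c < 1\<close> of the
  logarithm turns maxima of norms into minima of valuations.\<close>

lemma M_le: "0 < u \<Longrightarrow> t $ n \<noteq> 0 \<Longrightarrow> M u \<le> log c (vabs (t $ n)) + real n * u"
proof -
  assume u: "0 < u" and n: "t $ n \<noteq> 0"
  obtain N where "gauss_at t (c powr u) N (c powr M u)" using gauss_at_M[OF u] by blast
  then have "vabs (t $ n) * (c powr u) ^ n \<le> c powr M u" by (simp add: gauss_at_def gauss_le_def)
  then have "c powr (log c (vabs (t $ n)) + real n * u) \<le> c powr M u"
    by (subst (asm) vabs_eq_powr[OF n]) (simp add: powr_u_power powr_add)
  then show ?thesis by (simp only: powr_c_le_iff)
qed

lemma M_attained: "0 < u \<Longrightarrow> \<exists>N. t $ N \<noteq> 0 \<and> M u = log c (vabs (t $ N)) + real N * u"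
proof -
  assume u: "0 < u"
  obtain N where N: "gauss_at t (c powr u) N (c powr M u)" using gauss_at_M[OF u] by blast
  then have eq: "vabs (t $ N) * (c powr u) ^ N = c powr M u" by (simp add: gauss_at_def)
  then have nz: "t $ N \<noteq> 0" using c_pos by (metis mult_eq_0_iff powr_eq_0_iff vabs_0 less_irrefl)
  have "c powr (log c (vabs (t $ N)) + real N * u) = c powr M u"
    using eq by (subst (asm) vabs_eq_powr[OF nz]) (simp add: powr_u_power powr_add)
  then have "M u = log c (vabs (t $ N)) + real N * u" by (simp only: powr_c_eq_iff)
  then show ?thesis using nz by (intro exI[of _ N] conjI)
qed

lemma M_support: "0 < u \<Longrightarrow> \<exists>N::nat. \<forall>u'>0. M u' \<le> M u + real N * (u' - u)"
proof -
  assume "0 < u"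
  then obtain N where N: "t $ N \<noteq> 0" "M u = log c (vabs (t $ N)) + real N * u"
    using M_attained by blast
  have "M u' \<le> M u + real N * (u' - u)" if "u' > 0" for u'
    using M_le[OF that N(1)] N(2) by (simp add: algebra_simps)
  then show ?thesis by blast
qed

lemma M_functional_eq:
  assumes u: "0 < u"
  shows "min (real p * M u) (M u + real e) = M ((vstep q ^^ e) u)"
proof -
  have pos: "(vstep q ^^ k) u > 0" for k
    using u q_ge_2 by (induction k) (auto intro: vstep_pos)
  obtain N where N: "gauss_at t (c powr u) N (c powr M u)" using gauss_at_M[OF u] by blast
  obtain N' where N': "gauss_at t (c powr (vstep q ^^ e) u) N' (c powr M ((vstep q ^^ e) u))"
    using gauss_at_M[OF pos] by blast
  have "c powr M ((vstep q ^^ e) u) = max ((c powr M u) ^ p) (c ^ e * c powr M u)"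
    using gauss_functional_eq[OF u N N'] c_pos c_power_e by simp
  also have "\<dots> = max (c powr (real p * M u)) (c powr (M u + real e))"
    using c_pos by (simp add: powr_u_power powr_add powr_realpow mult.commute)
  finally show ?thesis by (simp add: powr_max powr_c_eq_iff)
qed

section \<open>The valuation of the period\<close>

abbreviation w :: real where "w \<equiv> log c (vabs \<Omega>)"

lemma M_eventually_line: "\<exists>U. \<forall>u\<ge>U. M u = u + w"
proof (intro exI allI impI)
  \<comment> \<open>Beyond \<open>max w 1\<close>, integrality gives each term with
    \<open>n \<ge> 2\<close> a valuation of at least \<open>2 * u \<ge> u + w\<close>.\<close>
  fix u assume u: "max w 1 \<le> u"
  then have u0: "0 < u" by simp
  have \<Omega>: "vabs \<Omega> = c powr w" using vabs_eq_powr[OF period_nonzero] .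
  have "log c (vabs (t $ n)) + real n * u \<ge> u + w" if "t $ n \<noteq> 0" for n
  proof (cases "n \<le> 1")
    case True
    then have "n = 1" using that t_nth_0 by (cases n) auto
    then show ?thesis using t_nth_1 by simp
  next
    case False
    have "c powr (log c (vabs (t $ n))) \<le> c powr 0"
      using vabs_t[of n] c_pos vabs_eq_powr[OF that] by simp
    then have "0 \<le> log c (vabs (t $ n))" by (simp only: powr_c_le_iff)
    moreover have "2 * u \<le> real n * u" using False u0 by (intro mult_right_mono) auto
    moreover have "w \<le> u" using u by simp
    ultimately show ?thesis by linarith
  qed
  moreover have "M u \<le> u + w" using M_le[OF u0, of 1] t_nth_1 period_nonzero by simp
  ultimately show "M u = u + w" using M_attained[OF u0] by (metis antisym)
qed

text \<open>Comparing coefficients in \<open>l oo br \<pi> = \<pi> * l\<close> expresses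
  \<open>(\<pi> - \<pi> ^ n) * l $ n\<close> through the earlier coefficients. The division costs a
  factor \<open>c\<close>, which the Gauss norm of [\<pi>] on this circle pays for.\<close>

lemma log_growth: "vabs (l $ n) * (c powr (1 / (real q - 1))) ^ n \<le> c powr (1 / (real q - 1))"
proof -
  define s where "s = c powr (1 / (real q - 1))"
  have q1: "real q - 1 > 0" using q_ge_2 by simp
  have s: "0 < s" "s < 1"
    using c_pos c_less_1 q1 powr_less_mono'[of c 0 "1 / (real q - 1)"] by (auto simp: s_def)
  have "s ^ (q - 1) = c powr (real (q - 1) * (1 / (real q - 1)))" by (simp add: s_def powr_u_power)
  also have "\<dots> = c" using q1 q_ge_2 c_pos by (simp add: of_nat_diff)
  finally have "s ^ (q - 1) = c" .
  \<comment> \<open>So \<open>Z^q\<close> and \<open>\<pi> Z\<close> balance at radius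
    \<open>s\<close>, and the Gauss norm of [\<pi>] is only \<open>c * s\<close>.\<close>
  then have sq: "s ^ q = c * s" using q_ge_2 by (metis One_nat_def Suc_le_D Suc_1 diff_Suc_1 power_Suc2)
  obtain N where "gauss_at (br \<pi>) s N (max (s ^ q) (c * s))" using gauss_at_br_pi[OF s] .
  then have br: "gauss_le (br \<pi> ^ j) s ((c * s) ^ j)" for j
    using gauss_le_power[OF gauss_at_imp_le s(1)] sq by simp
  have "vabs (l $ n) * s ^ n \<le> s"
  proof (induction n rule: less_induct)
    case (less n)
    consider "n = 0" | "n = 1" | "n \<ge> 2" by linarith
    then show ?case
    proof cases
      case 3
      have "\<pi> * l $ n = (\<Sum>j = 0..n. l $ j * (br \<pi> ^ j) $ n)"
        using arg_cong[OF log_br[OF pi_in], of "\<lambda>f. f $ n"] by (simp add: fps_compose_nth)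
      also have "\<dots> = (\<Sum>j<n. l $ j * (br \<pi> ^ j) $ n) + l $ n * \<pi> ^ n"
        using startsby_zero_power_nth_same[OF br_nth_0[OF pi_in], of n] br_nth_1[OF pi_in]
        by (simp add: atLeast0AtMost lessThan_Suc_atMost[symmetric])
      finally have "(\<pi> - \<pi> ^ n) * l $ n = (\<Sum>j<n. l $ j * (br \<pi> ^ j) $ n)"
        by (simp add: algebra_simps)
      moreover have "vabs (\<Sum>j<n. l $ j * (br \<pi> ^ j) $ n) * s ^ n \<le> c * s"
      proof (rule vabs_sum_weighted_le)
        fix j assume j: "j \<in> {..<n}"
        show "vabs (l $ j * (br \<pi> ^ j) $ n) * s ^ n \<le> c * s"
        proof (cases "j = 0")
          case False
          have "vabs (l $ j * (br \<pi> ^ j) $ n) * s ^ n = vabs (l $ j) * (vabs ((br \<pi> ^ j) $ n) * s ^ n)"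
            by (simp add: vabs_mult)
          also have "\<dots> \<le> vabs (l $ j) * (c * s) ^ j"
            using br[of j] by (intro mult_left_mono) (auto simp: gauss_le_def)
          also have "\<dots> = (vabs (l $ j) * s ^ j) * c ^ j" by (simp add: power_mult_distrib)
          also have "\<dots> \<le> s * c ^ 1"
            using less[of j] j False s c_pos c_less_1 by (intro mult_mono power_decreasing) auto
          finally show ?thesis by (simp add: mult.commute)
        qed (use log_nth s c_pos in simp)
      qed (use s c_pos in auto)
      moreover have "vabs (\<pi> - \<pi> ^ n) = c"
      proof -
        have "c ^ n < c ^ 1" using 3 c_pos c_less_1 by (intro power_strict_decreasing) auto
        then show ?thesis using vabs_add_eq[of "- (\<pi> ^ n)" \<pi>] by (simp add: vabs_power)
      qed
      ultimately have "c * (vabs (l $ n) * s ^ n) \<le> c * s" by (metis mult.assoc vabs_mult)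
      then show ?thesis using c_pos by simp
    qed (use log_nth s in auto)
  qed
  then show ?thesis by (simp add: s_def)
qed

text \<open>If the valuation of the period were larger, then \<open>exp((\<Omega>/\<pi>) l)\<close> would be integral as well,
  and \<open>t\<close> would be a multiple of \<open>t\<close> by an element of the maximal ideal.\<close>

lemma w_less: "w < real e / (real p - 1) - 1 / (real q - 1) + 1"
proof (rule ccontr)
  assume "\<not> w < real e / (real p - 1) - 1 / (real q - 1) + 1"
  then have w: "real e / (real p - 1) \<le> w - 1 + 1 / (real q - 1)" by simp
  have q1: "real q - 1 > 0" and p1: "real p - 1 > 0" using q_ge_2 p_ge_2 by auto
  define \<omega> where "\<omega> = \<Omega> / \<pi>"
  define t' where "t' = (fps_exp \<omega> oo l) - 1"
  define s where "s = c powr (1 / (real q - 1))"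
  \<comment> \<open>The radius \<open>p^(-1/(p-1))\<close> of the exponential; the negated claim
    says exactly that \<open>vabs \<omega> * s \<le> \<rho>\<close>.\<close>
  define \<rho> where "\<rho> = c powr (real e / (real p - 1))"
  have s: "0 < s" and \<rho>: "0 < \<rho>" using c_pos by (auto simp: s_def \<rho>_def)
  have "\<rho> ^ (p - 1) = c powr real e"
    using p1 p_ge_2 by (simp add: \<rho>_def powr_u_power of_nat_diff)
  also have "\<dots> = 1 / real p" using c_pos c_power_e by (simp add: powr_realpow)
  finally have \<rho>p: "\<rho> ^ (p - 1) = 1 / real p" .
  have "vabs \<omega> = c powr (w - 1)"
    using vabs_eq_powr[OF period_nonzero] c_pos by (simp add: \<omega>_def vabs_divide powr_diff)
  then have "vabs \<omega> * s = c powr (w - 1 + 1 / (real q - 1))" unfolding s_def powr_add by simp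
  also have "\<dots> \<le> \<rho>" unfolding \<rho>_def powr_c_le_iff by (rule w)
  finally have \<omega>s: "vabs \<omega> * s \<le> \<rho>" .
  have ls: "gauss_le l s s" using log_growth by (simp add: gauss_le_def s_def)
  have t'_nth: "t' $ n = (if n = 0 then 0 else (fps_exp \<omega> oo l) $ n)" for n
    by (simp add: t'_def)
  have growth: "vabs (t' $ n) * s ^ n \<le> 1" for n
  proof (cases "n = 0")
    case False
    have "vabs ((fps_exp \<omega> oo l) $ n) * s ^ n \<le> 1"
      unfolding fps_compose_nth
    proof (rule vabs_sum_weighted_le)
      fix k
      have "vabs (fps_exp \<omega> $ k * (l ^ k) $ n) * s ^ n
          = vabs \<omega> ^ k / vabs (fact k :: 'a) * (vabs ((l ^ k) $ n) * s ^ n)"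
        by (simp add: vabs_mult vabs_divide vabs_power)
      also have "\<dots> \<le> vabs \<omega> ^ k / \<rho> ^ k * s ^ k"
        using vabs_fact_ge[OF prime_p vabs_p \<rho> \<rho>p, of k] gauss_le_power[OF ls s, of k] s \<rho>
        by (intro mult_mono divide_left_mono) (auto simp: gauss_le_def)
      also have "\<dots> = (vabs \<omega> * s / \<rho>) ^ k" by (simp add: power_mult_distrib power_divide)
      also have "\<dots> \<le> 1" using \<omega>s s \<rho> by (intro power_le_one) auto
      finally show "vabs (fps_exp \<omega> $ k * (l ^ k) $ n) * s ^ n \<le> 1" .
    qed (use s in auto)
    then show ?thesis using False t'_nth by simp
  qed (simp add: t'_nth)
  have t'_br: "t' oo br \<pi> = t"
    using exp_log_br[OF pi_in, of \<omega>] pi_nonzero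
    by (simp add: t'_def fps_compose_sub_distrib \<omega>_def Delta1_def)
  \<comment> \<open>At this radius \<open>Z^q\<close> dominates [\<pi>] and takes the value
    \<open>s\<close>, the radius at which \<open>t'\<close> is under control.\<close>
  define r where "r = c powr (1 / (real q * (real q - 1)))"
  have rq: "r ^ q = s" using q_ge_2 by (simp add: r_def s_def powr_u_power)
  have r: "0 < r" "r < 1"
    using c_pos c_less_1 q1 q_ge_2 powr_less_mono'[of c 0 "1 / (real q * (real q - 1))"] by (auto simp: r_def)
  \<comment> \<open>The size of the rest of [\<pi>] relative to \<open>Z^q\<close>; it equals
    \<open>c powr (1 - 1 / q)\<close>.\<close>
  define \<kappa> where "\<kappa> = c * r / s"
  have int: "vabs (t' $ n) \<le> 1" for n
  proof (rule integral_of_compose[of "br \<pi>" q "br \<pi> - fps_X ^ q" r \<kappa> t'])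
    show "gauss_le (br \<pi> - fps_X ^ q) 1 1"
      unfolding gauss_le_def power_one mult_1_right
      using vabs_br_pi c_less_1 by (meson less_imp_le order_trans)
    show "gauss_le (br \<pi> - fps_X ^ q) r (\<kappa> * r ^ q)"
      unfolding gauss_le_def
    proof
      fix n
      have "vabs ((br \<pi> - fps_X ^ q) $ n) * r ^ n \<le> c * r"
      proof (cases "n = 0")
        case True
        then have "(br \<pi> - fps_X ^ q) $ n = 0" using br_nth_0[OF pi_in] q_ge_2 by simp
        then show ?thesis using c_pos r by simp
      next
        case False
        have "vabs ((br \<pi> - fps_X ^ q) $ n) * r ^ n \<le> c * r ^ 1"
          using vabs_br_pi[of n] False r c_pos by (intro mult_mono power_decreasing) auto
        then show ?thesis by simp
      qed
      then show "vabs ((br \<pi> - fps_X ^ q) $ n) * r ^ n \<le> \<kappa> * r ^ q" using s by (simp add: \<kappa>_def rq)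
    qed
    have "1 / (real q - 1) < 1 + 1 / (real q * (real q - 1))"
    proof -
      have "1 / (real q - 1) = 1 / real q + 1 / (real q * (real q - 1))" using q1 q_ge_2 by (simp add: field_simps)
      moreover have "1 / real q < 1" using q_ge_2 by simp
      ultimately show ?thesis by linarith
    qed
    then have "c powr (1 + 1 / (real q * (real q - 1))) < s"
      unfolding s_def using c_pos c_less_1 by (intro powr_less_mono') auto
    then have "c * r < s" using c_pos by (simp add: powr_add r_def)
    then show "\<kappa> < 1" using s by (simp add: \<kappa>_def)
    show "0 \<le> \<kappa>" using c_pos r s by (simp add: \<kappa>_def)
    show "vabs (t' $ i) * (r ^ q) ^ i \<le> 1" for i using growth by (simp add: rq)
    show "vabs ((t' oo br \<pi>) $ n) \<le> 1" for n using vabs_t by (simp add: t'_br)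
  qed (use q_ge_2 r in auto)
  have "formal_hom o_Cp F multiplicative_group t'"
    unfolding t'_def using int unfolding t'_def by (rule exp_log_hom[OF law log])
  then obtain a where a: "a \<in> o_ring L" "t' = t oo br a"
    using period unfolding is_period_def by blast
  have "t = (t oo br a) oo br \<pi>" using t'_br a by simp
  also have "\<dots> = t oo br (a * \<pi>)"
    using a pi_in by (simp add: br_mult fps_compose_assoc br_nth_0)
  finally have "a * \<pi> = 1"
    by (rule t_br_unique[OF o_ring_mult[OF a(1) pi_in] o_ring_1]) (simp add: br_1)
  then have "vabs a * c = 1" by (simp flip: vabs_mult)
  moreover have "vabs a * c \<le> 1 * c" using a c_pos by (intro mult_right_mono) (auto simp: o_ring_def)
  ultimately show False using c_less_1 by simp
qed

sublocale valuation_profile p e q w M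
  by unfold_locales
    (use p_ge_2 q_ge_2 e_ge_1 M_support M_functional_eq M_eventually_line w_less in auto)

section \<open>From segments of \<open>M\<close> to vertices\<close>

lemma v_pi_ge: "0 < u \<Longrightarrow> ereal (M u - real n * u) \<le> v_pi \<pi> (t $ n)"
  using M_le[of u n] by (auto simp: v_pi_def)

lemma u_crit_pos: "u_crit q m > 0"
  using q_ge_2 by (simp add: u_crit_def)

lemma u_crit_less: "u_crit q (Suc m) < u_crit q m"
proof -
  have "1 * (real q ^ m * (real q - 1)) < real q * (real q ^ m * (real q - 1))"
    using q_ge_2 by (intro mult_strict_right_mono) auto
  then show ?thesis using q_ge_2 unfolding u_crit_def by (intro divide_strict_left_mono) (auto simp: mult_ac)
qed

text \<open>The right end of a segment of \<open>M\<close>. The segment of index 0 is unbounded, so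
  any point beyond \<open>u_crit q 0\<close> serves.\<close>

definition u_above :: "nat \<Rightarrow> real" where
  "u_above m = (case m of 0 \<Rightarrow> u_crit q 0 + 1 | Suc k \<Rightarrow> u_crit q k)"

lemma u_crit_less_above: "u_crit q m < u_above m"
  using u_crit_less by (cases m) (auto simp: u_above_def)

lemma M_eq_vert:
  "u_crit q m \<le> u \<Longrightarrow> u \<le> u_above m \<Longrightarrow> M u = x_vert p e q m * u + y_vert p e q m"
  using M_segment_0[of u] M_segment[of m u] by (cases m) (auto simp: u_above_def)

text \<open>The term attaining the minimum at an interior point of a segment gives an affine
  function that stays above \<open>M\<close> and touches it there, so both agree on the segment. In
  particular \<open>x_vert p e q m\<close> is an integer.\<close>

lemma vertex_attained:
  obtains n where "x_vert p e q m = real n" "v_pi \<pi> (t $ n) = ereal (y_vert p e q m)"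
proof -
  define a b z where "a = u_crit q m" and "b = u_above m" and "z = (a + b) / 2"
  have ab: "0 < a" "a < z" "z < b" using u_crit_pos u_crit_less_above[of m] by (auto simp: a_def b_def z_def)
  then obtain n where n: "t $ n \<noteq> 0" "M z = log c (vabs (t $ n)) + real n * z"
    using M_attained[of z] by auto
  have M: "M u = x_vert p e q m * u + y_vert p e q m" if "a \<le> u" "u \<le> b" for u
    using that M_eq_vert by (simp add: a_def b_def)
  have "M a \<le> log c (vabs (t $ n)) + real n * a" "M b \<le> log c (vabs (t $ n)) + real n * b"
    using M_le n(1) ab by auto
  then have "(x_vert p e q m - real n) * (z - a) \<ge> 0" "(x_vert p e q m - real n) * (b - z) \<le> 0"
    using M[of a] M[of b] M[of z] n(2) ab by (simp_all add: algebra_simps)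
  then have "x_vert p e q m = real n"
    using ab by (auto simp: zero_le_mult_iff mult_le_0_iff)
  moreover have "v_pi \<pi> (t $ n) = ereal (y_vert p e q m)"
    using n M[of z] ab \<open>x_vert p e q m = real n\<close> by (simp add: v_pi_def)
  ultimately show ?thesis by (rule that)
qed

text \<open>The two ends of the segment of \<open>M\<close> provide the two supporting
  lines.\<close>

lemma vert_is_vertex: "(x_vert p e q m, y_vert p e q m) \<in> newton_vertices (v_pi \<pi>) t"
proof -
  obtain n where n: "x_vert p e q m = real n" "v_pi \<pi> (t $ n) = ereal (y_vert p e q m)"
    by (rule vertex_attained)
  have "ereal (y_vert p e q m + x_vert p e q m * u - real k * u) \<le> v_pi \<pi> (t $ k)"
    if "u = u_crit q m \<or> u = u_above m" for u k
  proof -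
    have "0 < u" using that u_crit_pos[of m] u_crit_less_above[of m] by auto
    then show ?thesis
      using v_pi_ge[of u k] M_eq_vert[of m u] that u_crit_less_above[of m] by (auto simp: add.commute)
  qed
  then show ?thesis
    using n u_crit_less_above[of m]
    by (intro newton_vertexI[where s = "u_crit q m" and t = "u_above m" and n = n]) auto
qed

section \<open>Unboundedness of the vertices outside degree one\<close>

lemma residue_representative:
  assumes "q = p" "x \<in> o_ring L"
  obtains j where "x - of_nat j \<in> max_ideal L"
proof -
  define R where "R = {(x, y). x \<in> o_ring L \<and> y \<in> o_ring L \<and> x - y \<in> max_ideal L}"
  have card: "card (o_ring L // R) = p" using assms(1) q_def by (simp add: residue_card_def R_def)
  have refl: "y \<in> R `` {y}" if "y \<in> o_ring L" for y
    using that by (simp add: R_def max_ideal_def o_ring_def rat_in_L)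
  define cls where "cls = (\<lambda>j::nat. R `` {of_nat j})"
  \<comment> \<open>Differences of distinct numbers below \<open>p\<close> are prime to
    \<open>p\<close>, hence units; so these numbers exhaust the \<open>p\<close> residue
    classes.\<close>
  have "inj_on cls {..<p}"
  proof (rule inj_onI)
    have aux: "i \<ge> j" if "i < p" "j < p" "cls i = cls j" for i j
    proof (rule ccontr)
      assume "\<not> i \<ge> j"
      then have ij: "0 < j - i" "j - i < p" using that by auto
      have "(of_nat i :: 'a) \<in> cls j" unfolding that(3)[symmetric] unfolding cls_def by (rule refl[OF o_ring_of_nat])
      then have "vabs (of_nat (j - i) :: 'a) < 1"
        using \<open>\<not> i \<ge> j\<close> by (simp add: cls_def R_def max_ideal_def of_nat_diff)
      moreover have "coprime (j - i) p"
        using ij prime_p by (metis coprime_commute nat_dvd_not_less prime_imp_coprime)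
      then have "vabs (of_nat (j - i) :: 'a) = 1"
        using p_ge_2 by (intro vabs_of_nat_coprime[of p]) (simp_all add: vabs_p)
      ultimately show False by simp
    qed
    fix i j assume "i \<in> {..<p}" "j \<in> {..<p}" "cls i = cls j"
    then show "i = j" using aux[of i j] aux[of j i] by simp
  qed
  then have "card (cls ` {..<p}) = p" by (simp add: card_image)
  moreover have "cls ` {..<p} \<subseteq> o_ring L // R"
    using o_ring_of_nat by (auto simp: cls_def quotient_def)
  moreover have "finite (o_ring L // R)" using card p_ge_2 by (intro card_ge_0_finite) simp
  ultimately have "cls ` {..<p} = o_ring L // R" using card by (intro card_subset_eq) auto
  moreover have "R `` {x} \<in> o_ring L // R" using assms(2) by (rule quotientI)
  ultimately obtain j where "R `` {x} = cls j" by auto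
  then have "(of_nat j, x) \<in> R" using refl[OF assms(2)] by (auto simp: cls_def)
  then have "of_nat j - x \<in> max_ideal L" by (simp add: R_def)
  then have "vabs (x - of_nat j) < 1"
    using vabs_minus[of "of_nat j - x"] by (simp add: max_ideal_def)
  moreover have "x - of_nat j \<in> L"
    using assms(2) rat_in_L[of "of_nat j"] L_diff by (simp add: o_ring_def)
  ultimately have "x - of_nat j \<in> max_ideal L" by (simp add: max_ideal_def)
  then show ?thesis by (rule that)
qed

text \<open>With \<open>p\<close> generating the maximal ideal and digits below \<open>p\<close>
  representing all residues, p-adic expansions approximate every integral element by
  rationals.\<close>

lemma L_subset_Qp:
  assumes "e = 1" "q = p"
  shows "L \<subseteq> Qp"
proof
  have approx: "\<exists>b\<in>\<rat>. vabs (x - b) \<le> c ^ k" if "x \<in> o_ring L" for x k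
    using that
  proof (induction k arbitrary: x)
    case 0
    then show ?case by (intro bexI[of _ 0]) (auto simp: o_ring_def)
  next
    case (Suc k)
    obtain j where "x - of_nat j \<in> max_ideal L" by (rule residue_representative[OF assms(2) Suc.prems])
    also have "max_ideal L = (*) (of_nat p) ` o_ring L"
      using ramification assms(1) pi_ideal by (simp add: is_ramification_index_def)
    finally obtain y where y: "y \<in> o_ring L" "x - of_nat j = of_nat p * y" by auto
    obtain b where b: "b \<in> \<rat>" "vabs (y - b) \<le> c ^ k" using Suc.IH[OF y(1)] by blast
    have "x - (of_nat j + of_nat p * b) = of_nat p * (y - b)" using y(2) by (simp add: algebra_simps)
    moreover have "vabs (of_nat p :: 'a) = c" using assms(1) c_power_e vabs_p by simp
    ultimately have "vabs (x - (of_nat j + of_nat p * b)) \<le> c ^ Suc k"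
      using b(2) c_pos by (simp add: vabs_mult)
    then show ?case using b(1) by (intro bexI[of _ "of_nat j + of_nat p * b"]) auto
  qed
  have c_to_0: "\<exists>k. c ^ k < \<epsilon>" if "\<epsilon> > 0" for \<epsilon>
    using real_arch_pow_inv[OF that c_less_1] .
  fix x assume x: "x \<in> L"
  have "\<exists>b\<in>\<rat>. dist b x < \<epsilon>" if \<epsilon>: "\<epsilon> > 0" for \<epsilon>
  proof -
    \<comment> \<open>Multiplication by \<open>p ^ k\<close> makes \<open>x\<close> integral; the
      summand 1 avoids dividing by 0.\<close>
    obtain k where k: "c ^ k < 1 / (vabs x + 1)" using c_to_0[of "1 / (vabs x + 1)"] vabs_nonneg[of x] by auto
    define P where "P = (of_nat p :: 'a) ^ k"
    have P: "P \<noteq> 0" "P \<in> \<rat>" using p_ge_2 by (auto simp: P_def)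
    have "vabs P = c ^ k" using assms(1) c_power_e vabs_p by (simp add: P_def vabs_power)
    then have "vabs (x * P) * (vabs x + 1) = vabs x * (c ^ k * (vabs x + 1))" by (simp add: vabs_mult)
    also have "\<dots> \<le> vabs x * 1"
      using k by (intro mult_left_mono) (simp_all add: pos_less_divide_eq add_nonneg_pos)
    also have "\<dots> \<le> vabs x + 1" by simp
    finally have "vabs (x * P) \<le> 1"
      using vabs_nonneg[of x] by (simp add: mult_le_cancel_right1 add_nonneg_pos)
    then have "x * P \<in> o_ring L" using x P by (simp add: o_ring_def L_mult rat_in_L)
    moreover obtain m where m: "c ^ m < \<epsilon> * vabs P" using c_to_0[of "\<epsilon> * vabs P"] \<epsilon> P by auto
    ultimately obtain b where b: "b \<in> \<rat>" "vabs (x * P - b) \<le> c ^ m" using approx by blast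
    have "x - b / P = (x * P - b) / P" using P by (simp add: field_simps)
    then have "vabs (x - b / P) = vabs (x * P - b) / vabs P" by (simp add: vabs_divide)
    also have "\<dots> < \<epsilon>" using b m P by (simp add: pos_divide_less_eq)
    finally have "dist x (b / P) < \<epsilon>" unfolding dist_vabs .
    then have "dist (b / P) x < \<epsilon>" by (metis dist_commute)
    moreover have "b / P \<in> \<rat>" using b(1) P(2) by (rule Rats_divide)
    ultimately show ?thesis by blast
  qed
  then show "x \<in> Qp" unfolding Qp_def closure_approachable by blast
qed

text \<open>Over \<open>L\<close> itself, two basis elements satisfy
  \<open>b2 * b1 - b1 * b2 = 0\<close>; uniqueness of coordinates would make both of them 0.\<close>

lemma degree_eq_1:
  assumes "e = 1" "q = p"
  shows "d = 1"
proof -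
  have L: "L = Qp" using L_subset_Qp[OF assms] finite_ext by (auto simp: finite_ext_Qp_def)
  obtain B where B: "finite B" "card B = d" "B \<subseteq> L"
    and unique: "\<And>x. x \<in> L \<Longrightarrow> \<exists>!f. f \<in> B \<rightarrow>\<^sub>E L \<and> x = (\<Sum>b\<in>B. f b * b)"
    using finite_ext L by (auto simp: finite_ext_Qp_def has_degree_def)
  have "B \<noteq> {}" using unique[of 1] rat_in_L[of 1] by auto
  moreover have "b1 = b2" if b: "b1 \<in> B" "b2 \<in> B" for b1 b2
  proof (rule ccontr)
    assume ne: "b1 \<noteq> b2"
    define f where "f = restrict (\<lambda>b. if b = b1 then b2 else if b = b2 then - b1 else 0) B"
    define g where "g = restrict (\<lambda>b. 0 :: 'a) B"
    have L0: "0 \<in> L" "- b1 \<in> L" "b2 \<in> L" using B b rat_in_L[of 0] L_diff[of 0 b1] by auto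
    have "(\<Sum>b\<in>B. f b * b) = (\<Sum>b\<in>{b1, b2}. f b * b)"
      using B b by (intro sum.mono_neutral_right) (auto simp: f_def)
    then have "(\<Sum>b\<in>B. f b * b) = 0" using b ne by (simp add: f_def)
    moreover have "(\<Sum>b\<in>B. g b * b) = 0" by (simp add: g_def)
    moreover have "f \<in> B \<rightarrow>\<^sub>E L" "g \<in> B \<rightarrow>\<^sub>E L" using L0 by (auto simp: f_def g_def)
    ultimately have "f = g" using unique[OF L0(1)] by metis
    then have "f b1 = g b1" "f b2 = g b2" by simp_all
    then show False using b ne by (simp add: f_def g_def)
  qed
  ultimately obtain b where "B = {b}" by blast
  then show ?thesis using B by simp
qed

text \<open>Every \<open>e\<close> steps multiply \<open>x\<close> by \<open>q ^ e / p\<close>,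
  which exceeds 1 unless \<open>e = 1\<close> and \<open>q = p\<close>, the case of degree
  one.\<close>

lemma x_vert_unbounded:
  assumes "d \<noteq> 1"
  shows "\<exists>m. B < x_vert p e q m"
\<comment> \<open>The polygon itself yields the divisibility: the vertex of index 1 has abscissa
  \<open>q / p\<close>, which is an integer.\<close>
proof -
  have pq: "p dvd q"
  proof -
    obtain n where n: "x_vert p e q 1 = real n" by (rule vertex_attained)
    then have "real q = real (p * n)" using p_ge_2 by (simp add: x_vert_def k_exp_def field_simps)
    then have "q = p * n" by (simp only: of_nat_eq_iff)
    then show ?thesis by simp
  qed
  have "p < q ^ e"
  proof (cases "e = 1")
    case True
    then have "q \<noteq> p" using degree_eq_1 assms by blast
    moreover have "p \<le> q" using pq q_ge_2 by (intro dvd_imp_le) auto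
    ultimately show ?thesis using True by simp
  next
    case False
    have "p \<le> q" using pq q_ge_2 by (intro dvd_imp_le) auto
    also have "\<dots> < q ^ e" using False e_ge_1 q_ge_2 power_strict_increasing[of 1 e q] by simp
    finally show ?thesis .
  qed
  then have gt1: "real q ^ e / real p > 1"
    using p_ge_2 by (simp flip: of_nat_power)
  have "x_vert p e q (k * e) = (real q ^ e / real p) ^ k" for k
  proof (induction k)
    case (Suc k)
    have "x_vert p e q (Suc k * e) = x_vert p e q (k * e + e)" by (simp add: add.commute)
    then show ?case using Suc x_vert_shift[OF e_ge_1 p_ge_2, of q "k * e"] by simp
  qed (simp add: x_vert_0[OF e_ge_1])
  then show ?thesis using real_arch_pow[OF gt1, of B] by metis
qed

lemma vertex_is_vert:
  assumes "d \<noteq> 1" "z \<in> newton_vertices (v_pi \<pi>) t"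
  shows "z \<in> range (\<lambda>m. (x_vert p e q m, y_vert p e q m))"
proof (rule newton_vertex_on_polygon[where u = "u_crit q"])
  show "v_pi \<pi> (t $ 0) = \<infinity>" unfolding t_nth_0 by (simp add: v_pi_def)
  show "(x_vert p e q m, y_vert p e q m) \<in> newton_region (v_pi \<pi>) t" for m
    using vert_is_vertex[of m] by (simp add: newton_vertices_def extreme_point_of_def)
  show "x_vert p e q 0 = 1" using e_ge_1 by (rule x_vert_0)
  show "\<exists>m. B < x_vert p e q m" for B using assms(1) by (rule x_vert_unbounded)
  have M: "M (u_crit q m) = x_vert p e q m * u_crit q m + y_vert p e q m" for m
    using u_crit_less_above[of m] by (intro M_eq_vert) auto
  show "ereal (y_vert p e q m + x_vert p e q m * u_crit q m - real n * u_crit q m) \<le> v_pi \<pi> (t $ n)" for m n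
    using v_pi_ge[OF u_crit_pos[of m], of n] by (simp add: M add.commute)
  show "y_vert p e q (Suc m) + x_vert p e q (Suc m) * u_crit q m = y_vert p e q m + x_vert p e q m * u_crit q m" for m
    using M[of m] M_eq_vert[of "Suc m" "u_crit q m"] u_crit_less[of m] by (simp add: u_above_def)
qed (rule assms(2))

end

theorem theorem3p44:
  fixes L :: "'a::{nonarch_normed_field, alg_closed_field, complete_space} set"
    and p d e q :: nat and \<pi> \<Omega> :: 'a
    and F :: "'a fps fps" and br :: "'a \<Rightarrow> 'a fps" and l :: "'a fps"
  assumes "is_Cp p TYPE('a)"
    and "finite_ext_Qp L d"
    and "is_uniformizer L \<pi>"
    and "is_ramification_index p L \<pi> e"
    and "q = residue_card L"
    and "lubin_tate_group L \<pi> F br"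
    and "is_formal_log L F l"
    and "is_period L F br l \<Omega>"
  shows "Delta1 \<Omega> l - 1 = Abs_fps (\<lambda>n. if n \<ge> 1 then poly (P_poly l n) \<Omega> else 0) \<and>
    range (\<lambda>m. (x_vert p e q m, y_vert p e q m)) \<subseteq> newton_vertices (v_pi \<pi>) (Delta1 \<Omega> l - 1) \<and>
    (d \<noteq> 1 \<longrightarrow>
      newton_vertices (v_pi \<pi>) (Delta1 \<Omega> l - 1) = range (\<lambda>m. (x_vert p e q m, y_vert p e q m)))"
proof -
  interpret lubin_tate_period L p d e q \<pi> \<Omega> F br l
    using assms by unfold_locales
  show ?thesis
    using Delta1_eq_P_poly vert_is_vertex vertex_is_vert by blast
qed

end
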